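(* Let $\lambda$ be the unique real root of $\lambda^3-\lambda^2-\lambda-1=0$ and let $c=1/(\lambda-1)$. Let $x\in[0,1]$ be represented by its continued fraction with minimal remainders $$x=\left[a_0;\frac{\varepsilon_1}{a_1},\ldots,\frac{\varepsilon_l}{a_l},\ldots\right].$$ Then $$F(x)=a_0-c\lambda\left(\frac{E_1}{\lambda^{A_1}}+\frac{E_2}{\lambda^{A_2}}+\ldots+\frac{E_j}{\lambda^{A_j}}+\ldots\right),$$ where $E_j=\prod_{1\leqslant i\leqslant j}(-\varepsilon_i)$ and $A_j=\sum_{0\leqslant i\leqslant j}a_i$. For rational $x=\left[a_0;\frac{\varepsilon_1}{a_1},\ldots,\frac{\varepsilon_l}{a_l}\right]$ the sum in this formula is finite (it runs over $1\leqslant j\leqslant l$).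
   Context: Continued fraction with minimal remainders: every real $x$ has a unique representation $$x=\left[a_0;\frac{\varepsilon_1}{a_1},\ldots,\frac{\varepsilon_l}{a_l},\ldots\right]=a_0+\cfrac{\varepsilon_1}{a_1+\cfrac{\varepsilon_2}{a_2+\ldots+\cfrac{\varepsilon_l}{a_l+\ldots}}},$$ finite if $x$ is rational and infinite if $x$ is irrational, where $a_0\in\mathbb{Z}$, $\varepsilon_j=\pm1$, $a_j\in\mathbb{Z}$, $a_j\geqslant 2$ for $j\geqslant1$, and $a_j+\varepsilon_{j+1}\geqslant2$ for $j\geqslant 1$ whenever $\varepsilon_{j+1}$ is present (equivalently, $a_j=2$ implies $\varepsilon_{j+1}=1$); for rational $x$, if the last partial quotient is $a_s=2$ with $s\geqslant1$, then $\varepsilon_s=1$. (It arises from the division $a=bq+r$, $-b/2<r\leqslant b/2$.) The numbers $a_i$ (including $a_0$) are the partial quotients. For rational $x$, $S(x)$ is the sum $a_0+a_1+\ldots+a_l$ of the partial quotients of this representation. Put $\mathcal{Z}_n=\{x\in\mathbb{Q}\cap[0,1]:S(x)\leqslant n+1\}$ (a finite set). The limit distribution function is $$F(x)=\lim_{n\to\infty}\frac{\#\{\xi\in\mathcal{Z}_n:\xi\leqslant x\}}{\#\mathcal{Z}_n},\qquad x\in[0,1].$$ *)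

theory Defs
  imports Complex_Main "HOL-Library.Extended_Nat"
begin

text \<open>
  A continued fraction is given by its partial quotients \<open>a 0, a 1, \<dots>\<close>, its signs
  \<open>\<epsilon> 1, \<epsilon> 2, \<dots>\<close> and the index \<open>l\<close> of its last partial quotient, with \<open>l = \<infinity>\<close> for an infinite
  continued fraction. The values \<open>\<epsilon> 0\<close> and \<open>a j\<close>, \<open>\<epsilon> j\<close> with \<open>j > l\<close> are irrelevant.

  \<open>cf_value a \<epsilon> k m\<close> is \<open>a k + \<epsilon> (k+1) / (a (k+1) + \<dots> + \<epsilon> (k+m) / a (k+m))\<close>.
\<close>

primrec cf_value :: "(nat \<Rightarrow> int) \<Rightarrow> (nat \<Rightarrow> int) \<Rightarrow> nat \<Rightarrow> nat \<Rightarrow> real" where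
  "cf_value a \<epsilon> k 0 = of_int (a k)"
| "cf_value a \<epsilon> k (Suc m) = of_int (a k) + of_int (\<epsilon> (Suc k)) / cf_value a \<epsilon> (Suc k) m"

definition minrem_admissible :: "enat \<Rightarrow> (nat \<Rightarrow> int) \<Rightarrow> (nat \<Rightarrow> int) \<Rightarrow> bool" where
  "minrem_admissible l a \<epsilon> \<longleftrightarrow>
     (\<forall>j\<ge>1. enat j \<le> l \<longrightarrow> \<epsilon> j \<in> {1, -1} \<and> a j \<ge> 2) \<and>
     (\<forall>j\<ge>1. enat (Suc j) \<le> l \<longrightarrow> a j + \<epsilon> (Suc j) \<ge> 2) \<and>
     (\<forall>s\<ge>1. l = enat s \<and> a s = 2 \<longrightarrow> \<epsilon> s = 1)"

definition minrem_cf :: "real \<Rightarrow> enat \<Rightarrow> (nat \<Rightarrow> int) \<Rightarrow> (nat \<Rightarrow> int) \<Rightarrow> bool" where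
  "minrem_cf x l a \<epsilon> \<longleftrightarrow>
     minrem_admissible l a \<epsilon> \<and>
     (case l of enat s \<Rightarrow> x = cf_value a \<epsilon> 0 s
              | \<infinity> \<Rightarrow> (\<lambda>m. cf_value a \<epsilon> 0 m) \<longlonglongrightarrow> x)"

text \<open>Only meaningful for rational \<open>x\<close>, whose representation is finite and unique.\<close>

definition minrem_sum :: "real \<Rightarrow> int" where
  "minrem_sum x = (THE t. \<exists>s a \<epsilon>. minrem_cf x (enat s) a \<epsilon> \<and> t = (\<Sum>i\<le>s. a i))"

definition minrem_Z :: "nat \<Rightarrow> real set" where
  "minrem_Z n = {x \<in> \<rat>. 0 \<le> x \<and> x \<le> 1 \<and> minrem_sum x \<le> int n + 1}"

definition minrem_ratio :: "nat \<Rightarrow> real \<Rightarrow> real" where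
  "minrem_ratio n x = real (card {\<xi> \<in> minrem_Z n. \<xi> \<le> x}) / real (card (minrem_Z n))"

definition minrem_F :: "real \<Rightarrow> real" where
  "minrem_F x = lim (\<lambda>n. minrem_ratio n x)"

definition minrem_lambda :: real where
  "minrem_lambda = (THE t. t ^ 3 - t ^ 2 - t - 1 = 0)"

definition minrem_c :: real where
  "minrem_c = 1 / (minrem_lambda - 1)"

definition cf_E :: "(nat \<Rightarrow> int) \<Rightarrow> nat \<Rightarrow> int" where
  "cf_E \<epsilon> j = (\<Prod>i=1..j. - \<epsilon> i)"

definition cf_A :: "(nat \<Rightarrow> int) \<Rightarrow> nat \<Rightarrow> int" where
  "cf_A a j = (\<Sum>i=0..j. a i)"

definition cf_term :: "(nat \<Rightarrow> int) \<Rightarrow> (nat \<Rightarrow> int) \<Rightarrow> nat \<Rightarrow> real" where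
  "cf_term a \<epsilon> j = of_int (cf_E \<epsilon> j) / minrem_lambda powi cf_A a j"

end

theory Submission
  imports Defs
begin

text \<open>
  Write \<open>S\<close> for the sum of the partial quotients and \<open>N(n, x)\<close> for the number of rationals
  \<open>\<xi> \<in> [0, x]\<close> with \<open>S(\<xi>) \<le> n\<close>. Since \<open>S(\<xi> + k) = S(\<xi>) + k\<close>, \<open>S(1/\<xi>) = S(\<xi>)\<close> on
  \<open>(0, 1/2]\<close> and \<open>S(-\<xi>) = S(\<xi>)\<close> on \<open>[0, 1/2)\<close>, inverting and translating intervals gives
  \<open>N(n + a, 1/(a + \<sigma> y)) = N(n + 2, 1/2) - \<sigma> N(n, y) + O(1)\<close>. The numbers \<open>N(n, 1/2) - 1\<close>
  satisfy the Tribonacci recurrence, so \<open>N(n, 1/2) / \<lambda>\<^sup>n\<close> tends to a positive constant.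
  Along the tails of the continued fraction of \<open>x\<close> the relation above contracts errors, hence
  \<open>N(n, x) / \<lambda>\<^sup>n\<close> converges to the solution of the limiting relation, which is the series.
  The interval \<open>[1/2, 1]\<close> is handled by \<open>\<xi> \<mapsto> 1 - \<xi>\<close>, which raises \<open>S\<close> by one.
\<close>

section \<open>Finite expansions and the sum of partial quotients\<close>

text \<open>A recursive form of the finite expansions. The conditions on neighbouring quotients and
  signs and the one on the last quotient merge into a single condition on the complete quotient
  \<open>z\<close>: it is at least 2, and strictly larger under the sign -1.\<close>

inductive minrem_rep :: "real \<Rightarrow> int \<Rightarrow> bool" where
  int: "minrem_rep (of_int n) n"
| cons: "minrem_rep z t \<Longrightarrow> 2 \<le> z \<Longrightarrow> e = 1 \<or> e = -1 \<and> 2 < z \<Longrightarrow>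
    minrem_rep (of_int n + of_int e / z) (n + t)"

lemma cf_value_shift:
  "cf_value (\<lambda>i. a (Suc i)) (\<lambda>i. \<epsilon> (Suc i)) k m = cf_value a \<epsilon> (Suc k) m"
  by (induction m arbitrary: k) auto

lemma cf_value_cong:
  assumes "\<And>i. k \<le> i \<Longrightarrow> a i = a' i" "\<And>i. k < i \<Longrightarrow> \<epsilon> i = \<epsilon>' i"
  shows "cf_value a \<epsilon> k m = cf_value a' \<epsilon>' k m"
  using assms by (induction m arbitrary: k) auto

text \<open>Either the next sign is 1, or it is -1 and \<open>a k\<close> is at least 3, while the
  next complete quotient contributes at most 1/2. The upper bound later keeps reciprocals of tails
  away from 0 in limits.\<close>

lemma cf_value_tail_bounds:
  assumes "minrem_admissible l a \<epsilon>" "1 \<le> k" "enat (k + m) \<le> l"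
  shows "2 \<le> cf_value a \<epsilon> k m \<and> cf_value a \<epsilon> k m \<le> of_int (a k) + 1/2 \<and>
    (0 < m \<longrightarrow> 2 < cf_value a \<epsilon> k m)"
  using assms(2,3)
proof (induction m arbitrary: k)
  case 0
  then show ?case using assms(1) by (auto simp: minrem_admissible_def)
next
  case (Suc m)
  define t where "t = cf_value a \<epsilon> (Suc k) m"
  have t: "2 \<le> t" using Suc.IH[of "Suc k"] Suc.prems by (simp add: t_def)
  have le: "enat (Suc k) \<le> l" "enat k \<le> l" 
    using Suc.prems by (cases l; simp)+
  have adm: "\<epsilon> (Suc k) \<in> {1,-1}" "a k \<ge> 2" "a k + \<epsilon> (Suc k) \<ge> 2"
    using assms(1) le Suc.prems(1) unfolding minrem_admissible_def by auto
  have inv: "0 < 1/t" "1/t \<le> 1/2" using t by (auto simp: field_simps)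
  have v: "cf_value a \<epsilon> k (Suc m) = of_int (a k) + of_int (\<epsilon> (Suc k)) / t" by (simp add: t_def)
  consider "\<epsilon> (Suc k) = 1" | "\<epsilon> (Suc k) = -1" "3 \<le> a k" using adm by auto
  then show ?case
  proof cases
    case 1
    have "(2::real) \<le> of_int (a k)" using adm by linarith
    moreover have "cf_value a \<epsilon> k (Suc m) = of_int (a k) + 1 / t" using v 1 by simp
    ultimately show ?thesis using inv by linarith
  next
    case 2
    have "(3::real) \<le> of_int (a k)" using 2 by linarith
    moreover have "cf_value a \<epsilon> k (Suc m) = of_int (a k) - 1 / t" using v 2 by simp
    ultimately show ?thesis using inv by linarith
  qed
qed

lemma minrem_cf_imp_rep:
  assumes "minrem_cf x (enat s) a \<epsilon>"
  shows "minrem_rep x (\<Sum>i\<le>s. a i)"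
  using assms
proof (induction s arbitrary: x a \<epsilon>)
  case 0
  then show ?case by (auto simp: minrem_cf_def intro: minrem_rep.int)
next
  case (Suc s)
  define z where "z = cf_value a \<epsilon> 1 s"
  have adm: "minrem_admissible (enat (Suc s)) a \<epsilon>" using Suc.prems by (simp add: minrem_cf_def)
  have "minrem_admissible (enat s) (\<lambda>i. a (Suc i)) (\<lambda>i. \<epsilon> (Suc i))"
    using adm unfolding minrem_admissible_def by auto
  then have "minrem_cf z (enat s) (\<lambda>i. a (Suc i)) (\<lambda>i. \<epsilon> (Suc i))"
    unfolding minrem_cf_def by (simp add: z_def cf_value_shift)
  from Suc.IH[OF this] have rep: "minrem_rep z (\<Sum>i\<le>s. a (Suc i))" .
  have z: "2 \<le> z" "0 < s \<longrightarrow> 2 < z"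
    using cf_value_tail_bounds[OF adm, of 1 s] by (auto simp: z_def)
  have e: "\<epsilon> 1 = 1 \<or> \<epsilon> 1 = -1" using adm unfolding minrem_admissible_def by auto
  \<comment> \<open>A tail equal to 2 must be the single last quotient 2, where admissibility
    forbids the sign -1.\<close>
  have "\<epsilon> 1 = 1 \<or> \<epsilon> 1 = -1 \<and> 2 < z"
  proof (cases "s = 0")
    case True
    then have "z = of_int (a 1)" by (simp add: z_def)
    moreover have "a 1 = 2 \<longrightarrow> \<epsilon> 1 = 1" using adm True unfolding minrem_admissible_def by auto
    ultimately show ?thesis using e z by (cases "z = 2") auto
  next
    case False
    then show ?thesis using e z by auto
  qed
  from minrem_rep.cons[OF rep z(1) this, of "a 0"] Suc.prems
  show ?case by (simp add: minrem_cf_def z_def sum.atMost_Suc_shift del: sum.atMost_Suc)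
qed

lemma minrem_rep_imp_cf:
  assumes "minrem_rep x t"
  shows "\<exists>s a \<epsilon>. minrem_cf x (enat s) a \<epsilon> \<and> t = (\<Sum>i\<le>s. a i)"
  using assms
proof induction
  case (int n)
  show ?case
    by (rule exI[of _ 0], rule exI[of _ "\<lambda>_. n"], rule exI[of _ "\<lambda>_. 1"])
      (auto simp: minrem_cf_def minrem_admissible_def)
next
  case (cons z t e n)
  then obtain s a \<epsilon> where cf: "minrem_cf z (enat s) a \<epsilon>" and t: "t = (\<Sum>i\<le>s. a i)" by blast
  have adm: "minrem_admissible (enat s) a \<epsilon>" and zv: "z = cf_value a \<epsilon> 0 s"
    using cf by (auto simp: minrem_cf_def)
  define b where "b = (\<lambda>i. if i = 0 then n else a (i - 1))"
  define d where "d = (\<lambda>i. if i = 1 then e else \<epsilon> (i - 1))"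
  \<comment> \<open>The quotient \<open>a 0\<close> moves to index 1 of the longer expansion and
    must now satisfy conditions from which index 0 is exempt. The size of \<open>z\<close> enforces
    them.\<close>
  have head: "2 \<le> a 0 \<and> (0 < s \<longrightarrow> 2 \<le> a 0 + \<epsilon> 1)"
  proof (cases s)
    case 0
    then show ?thesis using zv cons.hyps by simp
  next
    case (Suc m)
    have b: "2 \<le> cf_value a \<epsilon> 1 m" using cf_value_tail_bounds[OF adm, of 1 m] Suc by auto
    have v: "z = of_int (a 0) + of_int (\<epsilon> 1) / cf_value a \<epsilon> 1 m" using zv Suc by simp
    have inv: "0 < 1 / cf_value a \<epsilon> 1 m" "1 / cf_value a \<epsilon> 1 m \<le> 1/2"
      using b by (auto simp: field_simps)
    have "\<epsilon> 1 = 1 \<or> \<epsilon> 1 = -1" using adm Suc unfolding minrem_admissible_def by auto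
    then show ?thesis
    proof
      assume "\<epsilon> 1 = 1"
      then have "z = of_int (a 0) + 1 / cf_value a \<epsilon> 1 m" using v by simp
      then have "of_int (a 0) > (1::real)" using inv cons.hyps(2) by linarith
      then show ?thesis using \<open>\<epsilon> 1 = 1\<close> by simp
    next
      assume "\<epsilon> 1 = -1"
      then have "z = of_int (a 0) - 1 / cf_value a \<epsilon> 1 m" using v by simp
      then have "of_int (a 0) > (2::real)" using inv cons.hyps(2) by linarith
      then show ?thesis using \<open>\<epsilon> 1 = -1\<close> by simp
    qed
  qed
  have d0: "a 0 = 2 \<and> s = 0 \<longrightarrow> e = 1" using zv cons.hyps by auto
  have e: "e \<in> {1,-1}" using cons.hyps by auto
  have "minrem_admissible (enat (Suc s)) b d"
    unfolding minrem_admissible_def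
  proof (intro conjI allI impI)
    fix j :: nat assume j: "1 \<le> j" "enat j \<le> enat (Suc s)"
    then obtain i where i: "j = Suc i" by (cases j) auto
    show "d j \<in> {1, -1}" "b j \<ge> 2"
      using adm j head e unfolding i minrem_admissible_def by (cases i; auto simp: b_def d_def)+
  next
    fix j :: nat assume j: "1 \<le> j" "enat (Suc j) \<le> enat (Suc s)"
    then obtain i where i: "j = Suc i" by (cases j) auto
    show "b j + d (Suc j) \<ge> 2"
      using adm j head e unfolding i minrem_admissible_def by (cases i; auto simp: b_def d_def)
  next
    fix r :: nat assume r: "1 \<le> r" "enat (Suc s) = enat r \<and> b r = 2"
    then have "r = Suc s" by simp
    then show "d r = 1"
      using adm d0 r unfolding minrem_admissible_def by (cases s) (auto simp: b_def d_def)
  qed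
  moreover have "cf_value b d (Suc 0) s = cf_value a \<epsilon> 0 s"
  proof -
    have "cf_value b d (Suc 0) s = cf_value (\<lambda>i. b (Suc i)) (\<lambda>i. d (Suc i)) 0 s"
      by (simp add: cf_value_shift)
    also have "\<dots> = cf_value a \<epsilon> 0 s"
      by (rule cf_value_cong) (auto simp: b_def d_def)
    finally show ?thesis .
  qed
  ultimately have "minrem_cf (of_int n + of_int e / z) (enat (Suc s)) b d"
    by (simp add: minrem_cf_def zv) (simp add: b_def d_def)
  moreover have "n + t = (\<Sum>i\<le>Suc s. b i)"
    by (simp add: t sum.atMost_Suc_shift b_def del: sum.atMost_Suc)
  ultimately show ?case by blast
qed

section \<open>Uniqueness and existence of finite expansions\<close>

lemma nearest_int_unique:
  fixes r r' :: real
  assumes "of_int n + r = of_int n' + r'" "- (1/2) < r" "r \<le> 1/2" "- (1/2) < r'" "r' \<le> 1/2"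
  shows "n = n'"
proof -
  have "\<bar>of_int n - of_int n' :: real\<bar> < 1" using assms by linarith
  then show ?thesis by linarith
qed

lemma minrem_remainder_bounds:
  assumes "2 \<le> z" "e = 1 \<or> e = -1 \<and> 2 < z"
  shows "- (1/2) < of_int e / z" "of_int e / z \<le> (1/2::real)" "of_int e / z \<noteq> 0"
  using assms by (auto simp: field_simps)

text \<open>Remainders \<open>e / z\<close> are nonzero and lie in the half-open interval (-1/2,
  1/2], so \<open>x\<close> fixes \<open>n\<close> and whether the expansion stops. As
  \<open>z\<close> is positive, the remainder fixes \<open>e\<close> and \<open>z\<close>, and the
  induction continues with \<open>z\<close>.\<close>

lemma minrem_rep_unique: "minrem_rep x t \<Longrightarrow> minrem_rep x t' \<Longrightarrow> t = t'"
proof (induction arbitrary: t' rule: minrem_rep.induct)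
  case (int n)
  from int show ?case
  proof cases
    case int
    then show ?thesis by simp
  next
    case (cons z t e m)
    have "n = m" using nearest_int_unique[of n 0 m "of_int e / z"] minrem_remainder_bounds[OF cons(4,5)] cons(1)
      by simp
    then have "of_int e / z = 0" using cons(1) by simp
    then show ?thesis using minrem_remainder_bounds(3)[OF cons(4,5)] by blast
  qed
next
  case (cons z t e n)
  note b = minrem_remainder_bounds[OF cons.hyps(2,3)]
  from cons.prems show ?case
  proof cases
    case int
    then have "n = t'" using nearest_int_unique[of n "of_int e / z" t' 0] b by simp
    then have "of_int e / z = 0" using int by simp
    then show ?thesis using b(3) by blast
  next
    case (cons z' s e' m)
    note b' = minrem_remainder_bounds[OF cons(4,5)]
    have nm: "n = m" using nearest_int_unique[OF cons(1)] b b' by simp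
    then have eq: "of_int e / z = of_int e' / z'" using cons(1) by simp
    have "z = z'"
      using eq cons(4,5) \<open>2 \<le> z\<close> \<open>e = 1 \<or> e = -1 \<and> 2 < z\<close> by (auto simp: field_simps)
    then show ?thesis using cons.IH cons nm by simp
  qed
qed

text \<open>Euclid's algorithm with remainders of least absolute value: a step passes from
  denominator \<open>q\<close> to the smaller denominator \<open>\<bar>m\<bar>\<close>.\<close>

lemma minrem_rep_exists: "x \<in> \<rat> \<Longrightarrow> \<exists>t. minrem_rep x t"
proof -
  have *: "\<exists>t. minrem_rep (of_int p / of_nat q) t" if "0 < q" for p :: int and q :: nat
    using that
  proof (induction q arbitrary: p rule: less_induct)
    case (less q)
    \<comment> \<open>Nearest integer with ties rounded down, which puts the remainder into (-1/2,
      1/2].\<close>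
    define n where "n = \<lceil>of_int p / of_nat q - (1/2::real)\<rceil>"
    define m where "m = p - n * int q"
    define r where "r = (of_int m / of_nat q :: real)"
    have x: "of_int p / of_nat q = of_int n + r"
      using less.prems by (simp add: m_def r_def field_simps)
    have r: "- (1/2) < r" "r \<le> 1/2" 
      using x ceiling_correct[of "of_int p / of_nat q - (1/2::real)"] unfolding n_def by linarith+
    show ?case
    proof (cases "m = 0")
      case True
      then show ?thesis using x minrem_rep.int[of n] by (auto simp: r_def)
    next
      case False
      define z where "z = (of_nat q / of_nat (nat \<bar>m\<bar>) :: real)"
      have "\<bar>r\<bar> < 1" using r by linarith
      then have "\<bar>of_int m\<bar> < (of_nat q::real)" using less.prems by (simp add: r_def abs_divide)
      then have "nat \<bar>m\<bar> < q" by linarith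
      then obtain t where t: "minrem_rep z t"
        using less.IH[of "nat \<bar>m\<bar>" "int q"] False by (auto simp: z_def)
      have rz: "r = of_int (sgn m) / z"
        using False less.prems by (simp add: r_def z_def sgn_if)
      have zp: "0 < z" using False less.prems by (simp add: z_def)
      have e: "sgn m = 1 \<or> sgn m = -1" using False by (simp add: sgn_if)
      have "2 \<le> z" "sgn m = 1 \<or> sgn m = -1 \<and> 2 < z"
        using r rz zp e by (auto simp: field_simps)
      from minrem_rep.cons[OF t this] show ?thesis using x rz by auto
    qed
  qed
  assume "x \<in> \<rat>"
  then obtain p q where "0 < q" "x = of_int p / of_int q" by (auto elim: Rats_cases')
  then show ?thesis using *[of "nat q" p] by auto
qed

lemma minrem_sum_eq: "minrem_rep x t \<Longrightarrow> minrem_sum x = t"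
  unfolding minrem_sum_def
  by (rule the_equality) (use minrem_rep_imp_cf minrem_cf_imp_rep minrem_rep_unique in blast)+

lemma minrem_rep_sum: "x \<in> \<rat> \<Longrightarrow> minrem_rep x (minrem_sum x)"
  using minrem_rep_exists minrem_sum_eq by blast

section \<open>Translation, inversion and negation\<close>

lemma minrem_sum_add_int:
  assumes "x \<in> \<rat>"
  shows "minrem_sum (of_int n + x) = n + minrem_sum x"
proof -
  have "minrem_rep x t \<Longrightarrow> minrem_rep (of_int n + x) (n + t)" for t
  proof (induction rule: minrem_rep.induct)
    case (int m)
    then show ?case using minrem_rep.int[of "n + m"] by simp
  next
    case (cons z t e m)
    then show ?case using minrem_rep.cons[of z t e "n + m"] by (simp add: add.assoc)
  qed
  then show ?thesis using minrem_sum_eq minrem_rep_sum[OF assms] by blast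
qed

lemma minrem_sum_inverse:
  assumes "z \<in> \<rat>" "2 \<le> z"
  shows "minrem_sum (1 / z) = minrem_sum z"
  using minrem_sum_eq[OF minrem_rep.cons[OF minrem_rep_sum[OF assms(1)] assms(2), of 1 0]] by simp

lemma minrem_sum_0: "minrem_sum 0 = 0"
  using minrem_sum_eq[OF minrem_rep.int[of 0]] by simp

text \<open>For nonzero \<open>u\<close>, both \<open>u\<close> and \<open>- u\<close> expand
  through \<open>1 / u\<close> with integer part 0 and opposite signs. The sign -1 demands
  \<open>1 / u > 2\<close>, hence the strict bound.\<close>

lemma minrem_sum_minus:
  assumes "u \<in> \<rat>" "0 \<le> u" "u < 1/2"
  shows "minrem_sum (- u) = minrem_sum u"
proof (cases "u = 0")
  case False
  then have z: "1 / u \<in> \<rat>" "2 < 1 / u" using assms by (auto simp: field_simps)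
  from minrem_sum_eq[OF minrem_rep.cons[OF minrem_rep_sum[OF z(1)], of "-1" 0]] z(2)
    minrem_sum_inverse[OF z(1)]
  show ?thesis by simp
qed simp

text \<open>A remainder is at most 1/2, and \<open>z \<ge> 2\<close> keeps \<open>t\<close>
  nonnegative. Applied to \<open>1 / u\<close>, the bound makes sums positive on (0, 1/2].\<close>

lemma minrem_sum_ge:
  assumes "x \<in> \<rat>"
  shows "x - 1/2 \<le> of_int (minrem_sum x)"
proof -
  have "minrem_rep x t \<Longrightarrow> x - 1/2 \<le> of_int t" for x t
  proof (induction rule: minrem_rep.induct)
    case (cons z t e n)
    have "of_int n + of_int e / z - 1/2 \<le> of_int n + of_int t"
      using minrem_remainder_bounds(2)[OF cons.hyps(2,3)] cons.IH cons.hyps(2) by linarith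
    then show ?case by simp
  qed simp
  then show ?thesis using minrem_rep_sum[OF assms] by blast
qed

section \<open>Counting rationals by the sum of partial quotients\<close>

text \<open>\<open>M\<close> is an integer so that lowered levels such as \<open>N - 3\<close> are
  never truncated.\<close>

definition level :: "int \<Rightarrow> real set \<Rightarrow> real set" where
  "level M I = {u \<in> \<rat> \<inter> I. minrem_sum u \<le> M}"

lemma level_image:
  assumes "\<And>u. u \<in> I \<Longrightarrow> f u \<in> \<rat> \<longleftrightarrow> u \<in> \<rat>"
    and "\<And>u. u \<in> I \<Longrightarrow> u \<in> \<rat> \<Longrightarrow> minrem_sum (f u) = minrem_sum u + k"
  shows "level (M + k) (f ` I) = f ` level M I"
  using assms by (auto simp: level_def)

lemma level_union: "level M (I \<union> J) = level M I \<union> level M J"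
  by (auto simp: level_def)

lemma level_mono: "I \<subseteq> J \<Longrightarrow> level M I \<subseteq> level M J"
  by (auto simp: level_def)

lemma level_insert_0: "0 \<le> M \<Longrightarrow> level M (insert 0 I) = insert 0 (level M I)"
  by (auto simp: level_def minrem_sum_0)

lemma Rats_add_int_iff: "of_int n + x \<in> \<rat> \<longleftrightarrow> x \<in> (\<rat> :: real set)"
  by (metis Rats_add Rats_diff Rats_of_int add_diff_cancel_left')

lemma Rats_diff_int_iff: "of_int n - x \<in> \<rat> \<longleftrightarrow> x \<in> (\<rat> :: real set)"
  using Rats_add_int_iff[of n "-x"] by (metis Rats_minus_iff diff_conv_add_uminus)

lemma Rats_one_divide_iff: "1 / x \<in> \<rat> \<longleftrightarrow> x \<in> (\<rat> :: real set)"
  by (metis Rats_1 Rats_divide div_by_1 divide_divide_eq_right mult.left_neutral)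

lemma minrem_sum_half: "minrem_sum (1/2) = 2"
  using minrem_sum_inverse[of 2] minrem_sum_add_int[of 0 2] minrem_sum_0 by simp

lemma level_image_plus:
  assumes "2 \<le> a" "I \<subseteq> {0..1/2}"
  shows "level (M + a) ((\<lambda>u. 1 / (of_int a + u)) ` I) = (\<lambda>u. 1 / (of_int a + u)) ` level M I"
proof (rule level_image)
  fix u assume u: "u \<in> I"
  then show "1 / (of_int a + u) \<in> \<rat> \<longleftrightarrow> u \<in> \<rat>"
    by (simp only: Rats_one_divide_iff Rats_add_int_iff)
  assume q: "u \<in> \<rat>"
  have "(2::real) \<le> of_int a" "0 \<le> u" using assms u by auto
  then have "2 \<le> of_int a + u" by linarith
  with q show "minrem_sum (1 / (of_int a + u)) = minrem_sum u + a"
    by (simp add: minrem_sum_inverse minrem_sum_add_int)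
qed

text \<open>The point 1/2 is excluded because negation does not preserve its sum: 1/2 has sum 2, but
  -1/2 = -1 + 1/2 has sum 1. With \<open>a \<ge> 3\<close> the denominators exceed 2, so inversion
  preserves the sum.\<close>

lemma level_image_minus:
  assumes "3 \<le> a" "I \<subseteq> {0..<1/2}"
  shows "level (M + a) ((\<lambda>u. 1 / (of_int a - u)) ` I) = (\<lambda>u. 1 / (of_int a - u)) ` level M I"
proof (rule level_image)
  fix u assume u: "u \<in> I"
  then show "1 / (of_int a - u) \<in> \<rat> \<longleftrightarrow> u \<in> \<rat>"
    by (simp only: Rats_one_divide_iff Rats_diff_int_iff)
  assume q: "u \<in> \<rat>"
  have "(3::real) \<le> of_int a" "0 \<le> u" "u < 1/2" using assms u by auto
  then have "2 \<le> of_int a + (- u)" by linarith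
  with q \<open>0 \<le> u\<close> \<open>u < 1/2\<close> show "minrem_sum (1 / (of_int a - u)) = minrem_sum u + a"
    using minrem_sum_add_int[of "-u" a] by (simp add: minrem_sum_inverse minrem_sum_minus)
qed

text \<open>The map is translation by \<open>k\<close> conjugated by inversion: \<open>1 / u\<close>
  becomes \<open>k + 1 / u\<close>, and both inversions preserve the sum.\<close>

lemma level_shift:
  assumes "0 \<le> k"
  shows "level (M + k) {0<..1 / (of_int k + 2)}
    = (\<lambda>u. 1 / (of_int k + 1 / u)) ` level M {0<..1/2}"
proof -
  have k: "(0::real) \<le> of_int k" using assms by simp
  have "{0<..1 / (of_int k + 2)} = (\<lambda>u. 1 / (of_int k + 1 / u)) ` {0<..1/2::real}"
  proof (intro equalityI subsetI)
    fix x :: real assume x: "x \<in> {0<..1 / (of_int k + 2)}"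
    then have "of_int k + 2 \<le> 1 / x" using k by (auto simp: field_simps)
    then show "x \<in> (\<lambda>u. 1 / (of_int k + 1 / u)) ` {0<..1/2}"
      by (intro image_eqI[of _ _ "1 / (1 / x - of_int k)"]) (auto simp: field_simps)
  next
    fix x :: real assume "x \<in> (\<lambda>u. 1 / (of_int k + 1 / u)) ` {0<..1/2}"
    then obtain u where u: "0 < u" "u \<le> 1/2" "x = 1 / (of_int k + 1 / u)" by auto
    then have "2 \<le> 1 / u" by (auto simp: field_simps)
    then show "x \<in> {0<..1 / (of_int k + 2)}" using k u by (auto intro!: divide_left_mono)
  qed
  moreover have "level (M + k) ((\<lambda>u. 1 / (of_int k + 1 / u)) ` {0<..1/2})
    = (\<lambda>u. 1 / (of_int k + 1 / u)) ` level M {0<..1/2}"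
  proof (rule level_image)
    fix u :: real assume u: "u \<in> {0<..1/2}"
    show "1 / (of_int k + 1 / u) \<in> \<rat> \<longleftrightarrow> u \<in> \<rat>"
      by (simp only: Rats_one_divide_iff Rats_add_int_iff)
    assume q: "u \<in> \<rat>"
    have z: "2 \<le> 1 / u" "1 / u \<in> \<rat>" using u q by (auto simp: field_simps)
    then have "2 \<le> of_int k + 1 / u" using k by linarith
    with z show "minrem_sum (1 / (of_int k + 1 / u)) = minrem_sum u + k"
      using minrem_sum_inverse[OF z(2,1)] minrem_sum_inverse[of "of_int k + 1 / u"]
        minrem_sum_add_int[OF z(2), of k] by (simp add: Rats_add_int_iff)
  qed
  ultimately show ?thesis by simp
qed

section \<open>Interval images under the maps \<open>1 / (a + u)\<close> and
  \<open>1 / (a - u)\<close>\<close>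

lemma image_plus_left_open:
  assumes "0 < a" "0 \<le> y"
  shows "(\<lambda>u. 1 / (a + u)) ` {0..<y} = {1 / (a + y)<..1 / (a::real)}"
proof (intro equalityI subsetI)
  fix x assume x: "x \<in> {1 / (a + y)<..1 / a}"
  moreover have "0 < 1 / (a + y)" using assms by auto
  ultimately have "0 < x"
    unfolding greaterThanAtMost_iff greaterThanLessThan_iff atLeastAtMost_iff by linarith
  then show "x \<in> (\<lambda>u. 1 / (a + u)) ` {0..<y}" using x assms
    by (intro image_eqI[of _ _ "1 / x - a"]) (auto simp: field_simps)
qed (use assms in \<open>auto intro!: divide_left_mono divide_strict_left_mono mult_pos_pos\<close>)

lemma image_plus_closed:
  assumes "0 < a" "0 \<le> y"
  shows "(\<lambda>u. 1 / (a + u)) ` {0..y} = {1 / (a + y)..1 / (a::real)}"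
proof (intro equalityI subsetI)
  fix x assume x: "x \<in> {1 / (a + y)..1 / a}"
  moreover have "0 < 1 / (a + y)" using assms by auto
  ultimately have "0 < x"
    unfolding greaterThanAtMost_iff greaterThanLessThan_iff atLeastAtMost_iff by linarith
  then show "x \<in> (\<lambda>u. 1 / (a + u)) ` {0..y}" using x assms
    by (intro image_eqI[of _ _ "1 / x - a"]) (auto simp: field_simps)
qed (use assms in \<open>auto intro!: divide_left_mono divide_strict_left_mono mult_pos_pos\<close>)

lemma image_minus_left_open:
  assumes "y < a" "0 < a"
  shows "(\<lambda>u. 1 / (a - u)) ` {0<..y} = {1 / a<..1 / (a - y :: real)}"
proof (intro equalityI subsetI)
  fix x assume x: "x \<in> {1 / a<..1 / (a - y)}"
  moreover have "0 < 1 / a" using assms by auto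
  ultimately have "0 < x"
    unfolding greaterThanAtMost_iff greaterThanLessThan_iff atLeastAtMost_iff by linarith
  then show "x \<in> (\<lambda>u. 1 / (a - u)) ` {0<..y}" using x assms
    by (intro image_eqI[of _ _ "a - 1 / x"]) (auto simp: field_simps)
qed (use assms in \<open>auto intro!: divide_left_mono divide_strict_left_mono mult_pos_pos\<close>)

lemma image_minus_open:
  assumes "y < a" "0 < a"
  shows "(\<lambda>u. 1 / (a - u)) ` {0<..<y} = {1 / a<..<1 / (a - y :: real)}"
proof (intro equalityI subsetI)
  fix x assume x: "x \<in> {1 / a<..<1 / (a - y)}"
  moreover have "0 < 1 / a" using assms by auto
  ultimately have "0 < x"
    unfolding greaterThanAtMost_iff greaterThanLessThan_iff atLeastAtMost_iff by linarith
  then show "x \<in> (\<lambda>u. 1 / (a - u)) ` {0<..<y}" using x assms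
    by (intro image_eqI[of _ _ "a - 1 / x"]) (auto simp: field_simps)
qed (use assms in \<open>auto intro!: divide_left_mono divide_strict_left_mono mult_pos_pos\<close>)

text \<open>The three pieces of \<open>(0, 1/2]\<close> are \<open>1/u \<ge> 3\<close>, where \<open>1/u\<close> is lowered by one,
  \<open>1/u = 3 - v\<close> with \<open>0 < v < 1/2\<close>, and \<open>1/u = 2 + v\<close> with \<open>0 \<le> v \<le> 1/2\<close>.\<close>

lemma level_decomp:
  "level N {0<..1/2} = (\<lambda>u. 1 / (1 + 1 / u)) ` level (N - 1) {0<..1/2} \<union>
    ((\<lambda>u. 1 / (3 - u)) ` level (N - 3) {0<..<1/2} \<union> (\<lambda>u. 1 / (2 + u)) ` level (N - 2) {0..1/2})"
proof -
  \<comment> \<open>\<open>1 / (3 - 1/2)\<close> and \<open>1 / (2 + 1/2)\<close> are both 2/5, a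
    point that only the last piece contains.\<close>
  have "{0<..1/2::real} = {0<..1/3} \<union> ({1/3<..<1 / (3 - 1/2)} \<union> {1 / (2 + 1/2)..1/2})"
    by auto
  moreover have "level N {0<..1/3} = (\<lambda>u. 1 / (1 + 1 / u)) ` level (N - 1) {0<..1/2}"
    using level_shift[of 1 "N - 1"] by simp
  moreover have "level N {1/3<..<1 / (3 - 1/2)} = (\<lambda>u. 1 / (3 - u)) ` level (N - 3) {0<..<1/2}"
    using level_image_minus[of 3 "{0<..<1/2}" "N - 3"]
      image_minus_open[of "1/2" 3] by (simp add: subset_iff)
  moreover have "level N {1 / (2 + 1/2)..1/2} = (\<lambda>u. 1 / (2 + u)) ` level (N - 2) {0..1/2}"
    using level_image_plus[of 2 "{0..1/2}" "N - 2"]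
      image_plus_closed[of 2 "1/2"] by simp
  ultimately show ?thesis by (metis level_union)
qed

section \<open>Finiteness of the levels\<close>

lemma level_nonpos: "N \<le> 0 \<Longrightarrow> level N {0<..1/2} = {}"
proof (rule ccontr)
  assume N: "N \<le> 0" "level N {0<..1/2} \<noteq> {}"
  then obtain u where u: "u \<in> \<rat>" "0 < u" "u \<le> 1/2" "minrem_sum u \<le> 0"
    by (force simp: level_def)
  then have "2 \<le> 1 / u" "1 / u \<in> \<rat>" by (auto simp: field_simps)
  then show False using minrem_sum_inverse[of "1 / u"] minrem_sum_ge[of "1 / u"] u by auto
qed

lemma level_closed_half_subset: "level N {0..1/2} \<subseteq> insert 0 (level N {0<..1/2})"
  by (auto simp: level_def)

text \<open>Up to the point 0, the decomposition refers only to levels lowered by 1, 2 or 3, and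
  levels up to 0 are empty. Strong induction on the level therefore applies.\<close>

lemma finite_level_left_open: "finite (level N {0<..1/2})"
proof -
  have "finite (level (int n) {0<..1/2})" for n
  proof (induction n rule: less_induct)
    case (less n)
    have fin: "finite (level (int n - k) {0<..1/2})" if "0 < k" for k
    proof (cases "int n - k \<le> 0")
      case False
      then show ?thesis using less[of "nat (int n - k)"] that by simp
    qed (simp add: level_nonpos)
    have "finite (level (int n - 3) {0<..<1/2})"
      by (rule finite_subset[OF level_mono fin[of 3]]) auto
    moreover have "finite (level (int n - 2) {0..1/2})"
      using finite_subset[OF level_closed_half_subset] fin[of 2] by simp
    ultimately show ?case using fin[of 1] by (subst level_decomp) simp
  qed
  from this[of "nat N"] show ?thesis by (cases "N \<le> 0") (auto simp: level_nonpos)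
qed

lemma finite_level:
  assumes "I \<subseteq> {0..1/2}"
  shows "finite (level N I)"
  using finite_subset[OF level_mono[OF assms]]
    finite_subset[OF level_closed_half_subset] finite_level_left_open by simp

section \<open>Counting relations on [0, 1/2]\<close>

definition cnt :: "int \<Rightarrow> real set \<Rightarrow> nat" where
  "cnt M I = card (level M I)"

lemma cnt_insert_0:
  assumes "0 \<le> M" "0 \<notin> I" "I \<subseteq> {0..1/2}"
  shows "cnt M (insert 0 I) = Suc (cnt M I)"
proof -
  have "0 \<notin> level M I" using assms(2) by (simp add: level_def)
  then show ?thesis using finite_level[OF assms(3)] by (simp add: cnt_def level_insert_0 assms(1))
qed

lemma cnt_closed:
  assumes "0 \<le> M" "0 \<le> y" "y \<le> 1/2"
  shows "cnt M {0..y} = cnt M {0<..y} + 1"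
proof -
  have "{0..y} = insert 0 {0<..y}" "{0<..y} \<subseteq> {0..1/2}" using assms by auto
  then show ?thesis using cnt_insert_0[OF assms(1), of "{0<..y}"] by simp
qed

lemma cnt_disjoint_union:
  assumes "I \<subseteq> {0..1/2}" "J \<subseteq> {0..1/2}" "I \<inter> J = {}"
  shows "cnt M (I \<union> J) = cnt M I + cnt M J"
proof -
  have "level M I \<inter> level M J = {}" using assms(3) by (auto simp: level_def)
  then show ?thesis
    by (simp add: cnt_def level_union card_Un_disjoint finite_level assms)
qed

lemma cnt_mono: "I \<subseteq> J \<Longrightarrow> J \<subseteq> {0..1/2} \<Longrightarrow> cnt M I \<le> cnt M J"
  unfolding cnt_def by (rule card_mono[OF finite_level level_mono])

lemma cnt_half_open:
  assumes "0 \<le> y" "y \<le> 1/2"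
  shows "cnt M {0..<y} \<le> cnt M {0..y}" "cnt M {0..y} \<le> cnt M {0..<y} + 1"
proof -
  show "cnt M {0..<y} \<le> cnt M {0..y}" using assms by (intro cnt_mono) auto
  have fin: "finite (level M {0..<y})" by (rule finite_level) (use assms in auto)
  have "level M {0..y} \<subseteq> insert y (level M {0..<y})" by (auto simp: level_def)
  then have "card (level M {0..y}) \<le> card (insert y (level M {0..<y}))"
    using fin by (intro card_mono) auto
  also have "\<dots> \<le> card (level M {0..<y}) + 1"
    using fin by (simp add: card_insert_if)
  finally show "cnt M {0..y} \<le> cnt M {0..<y} + 1" by (simp add: cnt_def)
qed

lemma cnt_shift:
  assumes "0 \<le> k"
  shows "cnt (M + k) {0<..1 / (of_int k + 2)} = cnt M {0<..1/2}"
proof -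
  have "inj_on (\<lambda>u. 1 / (of_int k + 1 / u :: real)) A" for A
    by (auto simp: inj_on_def)
  then show ?thesis unfolding cnt_def level_shift[OF assms] by (simp add: card_image)
qed

text \<open>The shift by \<open>a - 2\<close> carries (0, 1/2] onto (0, 1/a]. The point 0 is counted
  on both sides because \<open>0 \<le> M\<close>.\<close>

lemma cnt_initial:
  assumes "0 \<le> M" "2 \<le> a"
  shows "cnt (M + a) {0..1 / of_int a} = cnt (M + 2) {0..1/2}"
proof -
  have a: "(2::real) \<le> of_int a" using assms by simp
  have "1 / of_int a \<le> (1/2::real)" "0 \<le> (1 / of_int a :: real)" using a by (auto simp: field_simps)
  then show ?thesis
    using cnt_shift[of "a - 2" "M + 2"] assms
    by (simp add: cnt_closed)
qed

text \<open>Cut [0, 1/a] at \<open>1 / (a + y)\<close>. The upper part is the image of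
  \<open>{0..<y}\<close>; since the map reverses order, leaving out the cut point means leaving out
  \<open>y\<close>.\<close>

lemma cnt_step_plus:
  assumes "0 \<le> M" "2 \<le> a" "0 \<le> y" "y \<le> 1/2"
  shows "cnt (M + a) {0..1 / (of_int a + y)} + cnt M {0..<y} = cnt (M + 2) {0..1/2}"
proof -
  have a: "(2::real) \<le> of_int a" using assms by simp
  have le: "1 / (of_int a + y) \<le> 1 / of_int a" "1 / of_int a \<le> (1/2::real)"
    "0 \<le> 1 / (of_int a + y)" using a assms by (auto simp: field_simps)
  then have "{0..1 / of_int a} = {0..1 / (of_int a + y)} \<union> {1 / (of_int a + y)<..1 / of_int a}"
    by (intro ivl_disj_un_two(8)[symmetric])
  moreover have "{0..1 / (of_int a + y)} \<subseteq> {0..1/2}"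
    "{1 / (of_int a + y)<..1 / of_int a} \<subseteq> {0..1/2}"
    unfolding subset_iff greaterThanAtMost_iff atLeastAtMost_iff
    by (intro allI impI conjI; use le in linarith)+
  ultimately have "cnt (M + 2) {0..1/2} = cnt (M + a) {0..1 / (of_int a + y)}
      + cnt (M + a) {1 / (of_int a + y)<..1 / of_int a}"
    unfolding cnt_initial[OF assms(1,2), symmetric] by (subst cnt_disjoint_union[symmetric]) auto
  moreover have "cnt (M + a) {1 / (of_int a + y)<..1 / of_int a} = cnt M {0..<y}"
  proof -
    have "{1 / (of_int a + y)<..1 / of_int a} = (\<lambda>u. 1 / (of_int a + u)) ` {0..<y}"
      using a assms by (subst image_plus_left_open) auto
    moreover have "{0..<y} \<subseteq> {0..1/2}" using assms by auto
    moreover have "inj_on (\<lambda>u. 1 / (of_int a + u :: real)) A" for A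
      by (auto simp: inj_on_def)
    ultimately show ?thesis
      using level_image_plus[OF assms(2), of "{0..<y}" M] by (simp add: cnt_def card_image)
  qed
  ultimately show ?thesis by simp
qed

text \<open>Here [0, 1/a] is extended by the image of \<open>{0<..y}\<close>. The 1 on the left
  accounts for the point 0 of \<open>{0..y}\<close>, whose image 1/a already belongs to
  [0, 1/a].\<close>

lemma cnt_step_minus:
  assumes "0 \<le> M" "3 \<le> a" "0 \<le> y" "y < 1/2"
  shows "cnt (M + a) {0..1 / (of_int a - y)} + 1 = cnt (M + 2) {0..1/2} + cnt M {0..y}"
proof -
  have a: "(3::real) \<le> of_int a" using assms by simp
  have le: "1 / of_int a \<le> 1 / (of_int a - y)" "1 / (of_int a - y) \<le> (1/2::real)"
    "0 \<le> (1 / of_int a :: real)" using a assms by (auto simp: field_simps)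
  then have "{0..1 / (of_int a - y)} = {0..1 / of_int a} \<union> {1 / of_int a<..1 / (of_int a - y)}"
    by (intro ivl_disj_un_two(8)[symmetric])
  moreover have "{0..1 / of_int a :: real} \<subseteq> {0..1/2}"
    "{1 / of_int a<..1 / (of_int a - y)} \<subseteq> {0..1/2}"
    unfolding subset_iff greaterThanAtMost_iff atLeastAtMost_iff
    by (intro allI impI conjI; use le in linarith)+
  moreover have "cnt (M + a) {0..1 / of_int a} = cnt (M + 2) {0..1/2}"
    using assms by (intro cnt_initial) auto
  ultimately have "cnt (M + a) {0..1 / (of_int a - y)} = cnt (M + 2) {0..1/2}
      + cnt (M + a) {1 / of_int a<..1 / (of_int a - y)}"
    by (metis cnt_disjoint_union ivl_disj_int_two(8))
  moreover have "cnt (M + a) {1 / of_int a<..1 / (of_int a - y)} = cnt M {0<..y}"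
  proof -
    have "{1 / of_int a<..1 / (of_int a - y)} = (\<lambda>u. 1 / (of_int a - u)) ` {0<..y}"
      using a assms by (subst image_minus_left_open) auto
    moreover have "{0<..y} \<subseteq> {0..<1/2}" using assms by auto
    moreover have "inj_on (\<lambda>u. 1 / (of_int a - u :: real)) A" for A
      by (auto simp: inj_on_def)
    ultimately show ?thesis
      using level_image_minus[OF assms(2), of "{0<..y}" M] by (simp add: cnt_def card_image)
  qed
  moreover have "cnt M {0..y} = cnt M {0<..y} + 1"
    using assms by (simp add: cnt_closed)
  ultimately show ?thesis by simp
qed

lemma level_half_remove: "2 \<le> N \<Longrightarrow> level N {0<..1/2} = insert (1/2) (level N {0<..<1/2})"
  by (auto simp: level_def minrem_sum_half)

text \<open>The three pieces of (0, 1/2] are counted separately; the point 1/2 missing from the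
  second and the extra point 0 in the third cancel. The bound on \<open>N\<close> puts 1/2, of sum
  2, into level \<open>N - 3\<close>.\<close>

lemma cnt_tribonacci:
  assumes "5 \<le> N"
  shows "cnt N {0<..1/2} = cnt (N - 1) {0<..1/2} + cnt (N - 2) {0<..1/2} + cnt (N - 3) {0<..1/2}"
proof -
  let ?h = "{0<..1/2::real}"
  have d: "?h = {0<..1/3} \<union> ({1/3<..<1 / (3 - 1/2)} \<union> {1 / (2 + 1/2)..1/2})"
    by auto
  have "cnt N ?h = cnt N {0<..1/3} + (cnt N {1/3<..<1 / (3 - 1/2)} + cnt N {1 / (2 + 1/2)..1/2})"
    by (subst d, subst cnt_disjoint_union) (auto intro!: cnt_disjoint_union)
  moreover have "cnt N {0<..1/3} = cnt (N - 1) ?h" using cnt_shift[of 1 "N - 1"] by simp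
  moreover have "cnt N {1/3<..<1 / (3 - 1/2)} = cnt (N - 3) {0<..<1/2}"
  proof -
    have "inj_on (\<lambda>u. 1 / (3 - u :: real)) A" for A by (auto simp: inj_on_def)
    moreover have "(\<lambda>u. 1 / (3 - u)) ` {0<..<1/2} = {1/3<..<1 / (3 - 1/2 :: real)}"
      by (rule image_minus_open) auto
    moreover have "{0<..<1/2} \<subseteq> {0..<1/2::real}" by auto
    ultimately show ?thesis using level_image_minus[of 3 "{0<..<1/2}" "N - 3"]
      by (simp add: cnt_def card_image)
  qed
  moreover have "cnt N {1 / (2 + 1/2)..1/2} = cnt (N - 2) {0..1/2}"
  proof -
    have "inj_on (\<lambda>u. 1 / (2 + u :: real)) A" for A by (auto simp: inj_on_def)
    moreover have "(\<lambda>u. 1 / (2 + u)) ` {0..1/2} = {1 / (2 + 1/2)..1/2 :: real}"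
      by (rule image_plus_closed) auto
    ultimately show ?thesis using level_image_plus[of 2 "{0..1/2}" "N - 2"]
      by (simp add: cnt_def card_image)
  qed
  moreover have "cnt (N - 3) ?h = cnt (N - 3) {0<..<1/2} + 1"
  proof -
    have "finite (level (N - 3) {0<..<1/2})" by (rule finite_level) auto
    then show ?thesis using level_half_remove[of "N - 3"] assms
      by (simp add: cnt_def) (simp add: level_def)
  qed
  moreover have "cnt (N - 2) {0..1/2} = cnt (N - 2) ?h + 1"
    using assms by (simp add: cnt_closed)
  ultimately show ?thesis by simp
qed

lemma cnt_pos: "2 \<le> N \<Longrightarrow> 0 < cnt N {0<..1/2}"
  using finite_level_left_open[of N] level_half_remove[of N] by (auto simp: cnt_def card_gt_0_iff)

section \<open>Growth of the Tribonacci recurrence\<close>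

text \<open>The bracket is narrow enough for the later estimates \<lambda> > 3/2, \<lambda> - 1
  \<le> 9/10 and \<lambda>^2 \<ge> 3.\<close>

lemma minrem_lambda_exists: "\<exists>t::real. 9/5 \<le> t \<and> t \<le> 19/10 \<and> t ^ 3 - t ^ 2 - t - 1 = 0"
  by (rule IVT'[of "\<lambda>t. t ^ 3 - t ^ 2 - t - 1" "9/5" 0 "19/10"])
    (auto simp: power3_eq_cube power2_eq_square intro!: continuous_intros)

lemma tribonacci_root_unique:
  fixes s t :: real
  assumes "s ^ 3 - s ^ 2 - s - 1 = 0" "9/5 \<le> s" "t ^ 3 - t ^ 2 - t - 1 = 0"
  shows "t = s"
proof (rule ccontr)
  assume "t \<noteq> s"
  have "(t - s) * (t ^ 2 + (s - 1) * t + (s ^ 2 - s - 1)) = 0"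
    using assms(1,3) by algebra
  then have "t ^ 2 + (s - 1) * t + (s ^ 2 - s - 1) = 0" using \<open>t \<noteq> s\<close> by simp
  \<comment> \<open>Four times the quadratic cofactor with the square completed; its discriminant is
    negative because \<open>3 * s > 5\<close>.\<close>
  then have "(2 * t + (s - 1)) ^ 2 + (3 * s - 5) * (s + 1) = 0" by algebra
  moreover have "0 < (3 * s - 5) * (s + 1)" using assms(2) by simp
  ultimately show False by (smt (verit) zero_le_power2)
qed

lemma minrem_lambda:
  "minrem_lambda ^ 3 = minrem_lambda ^ 2 + minrem_lambda + 1"
  "9/5 \<le> minrem_lambda" "minrem_lambda \<le> 19/10"
proof -
  obtain s :: real where s: "9/5 \<le> s" "s \<le> 19/10" "s ^ 3 - s ^ 2 - s - 1 = 0"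
    using minrem_lambda_exists by blast
  have "minrem_lambda = s" unfolding minrem_lambda_def
    by (rule the_equality) (use s tribonacci_root_unique in auto)
  then show "minrem_lambda ^ 3 = minrem_lambda ^ 2 + minrem_lambda + 1"
    "9/5 \<le> minrem_lambda" "minrem_lambda \<le> 19/10" using s by auto
qed

text \<open>The two non-real roots of the characteristic polynomial are smaller than \<open>3/2\<close> in modulus,
  which bounds \<open>d\<close>; the weighted sum \<open>\<Lambda>\<close> of three consecutive terms is an exact eigenvector
  and shows that the limit is not zero.\<close>

lemma tribonacci_growth:
  fixes q :: "nat \<Rightarrow> real"
  assumes rec: "\<And>n. q (n + 3) = q (n + 2) + q (n + 1) + q n"
    and pos: "\<And>n. 0 < q n"
  shows "\<exists>C>0. (\<lambda>n. q n / minrem_lambda ^ n) \<longlonglongrightarrow> C"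
proof -
  define b where "b = minrem_lambda"
  note bb = minrem_lambda[folded b_def]
  have b3: "b * b * b = b * b + b + 1" using bb(1) by (simp add: power3_eq_cube power2_eq_square)
  define r where "r n = q n / b ^ n" for n
  define d where "d n = q (n + 1) - b * q n" for n
  \<comment> \<open>Passing to \<open>d\<close> divides the root \<open>b\<close> out of the
    characteristic polynomial. What remains is t^2 + (b - 1) t + 1/b, here multiplied by
    \<open>b\<close>.\<close>
  have d_rec: "b * d (n + 2) = - (b * (b - 1)) * d (n + 1) - d n" for n
  proof -
    have "b * d (n + 2) + b * (b - 1) * d (n + 1) + d n
      = - (b * b * b - b * b - b - 1) * q (n + 1)"
      using rec[of n] by (simp add: d_def algebra_simps eval_nat_numeral)
    then show ?thesis using b3 by simp
  qed
  define K where "K = \<bar>d 0\<bar> + \<bar>d 1\<bar>"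
  have bound: "\<bar>d n\<bar> \<le> K * (3/2) ^ n \<and> \<bar>d (Suc n)\<bar> \<le> K * (3/2) ^ Suc n" for n
  proof (induction n)
    case 0
    then show ?case by (auto simp: K_def)
  next
    case (Suc n)
    have K: "0 \<le> K * (3/2) ^ n" by (simp add: K_def)
    have "b * \<bar>d (n + 2)\<bar> = \<bar>b * d (n + 2)\<bar>" using bb by (simp add: abs_mult)
    also have "\<dots> \<le> b * (b - 1) * \<bar>d (Suc n)\<bar> + \<bar>d n\<bar>"
    proof -
      have "\<bar>b * (b - 1) * d (Suc n)\<bar> = b * (b - 1) * \<bar>d (Suc n)\<bar>" using bb by (simp add: abs_mult)
      then show ?thesis unfolding d_rec by simp
    qed
    also have "\<dots> \<le> b * (b - 1) * (K * (3/2) ^ Suc n) + K * (3/2) ^ n"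
      using Suc.IH bb by (intro add_mono mult_left_mono) auto
    also have "\<dots> = (b * (b - 1) * (3/2) + 1) * (K * (3/2) ^ n)" by (simp add: algebra_simps)
    \<comment> \<open>The factor 9/4 is (3/2)^2. By \<open>b - 1 \<le> 9/10\<close> the claim
      reduces to 1 \<le> 9/10 b.\<close>
    also have "\<dots> \<le> (b * (9/4)) * (K * (3/2) ^ n)"
    proof (intro mult_right_mono K)
      have "b * (b - 1) \<le> b * (9/10)" using bb by (intro mult_left_mono) auto
      then show "b * (b - 1) * (3/2) + 1 \<le> b * (9/4)" using bb by linarith
    qed
    finally have "\<bar>d (n + 2)\<bar> \<le> (9/4) * (K * (3/2) ^ n)" using bb by simp
    then show ?case using Suc.IH by simp
  qed
  have diff: "r (Suc n) - r n = d n / b ^ Suc n" for n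
    using bb by (simp add: r_def d_def field_simps)
  \<comment> \<open>The increments are dominated by a geometric series of ratio
    \<open>3/2 / b\<close> < 1; telescoping then gives a limit of \<open>r\<close>.\<close>
  have "summable (\<lambda>n. r (Suc n) - r n)"
  proof (rule summable_comparison_test)
    show "summable (\<lambda>n. K / b * (3/2 / b) ^ n)"
      using bb by (intro summable_mult summable_geometric) auto
    have geom: "K * c ^ n / b ^ Suc n = K / b * (c / b) ^ n" for c n
      by (simp add: power_divide)
    have "norm (r (Suc n) - r n) \<le> K / b * (3/2 / b) ^ n" for n
    proof -
      have "norm (r (Suc n) - r n) = \<bar>d n\<bar> / b ^ Suc n" using bb by (simp add: diff abs_divide)
      also have "\<dots> \<le> K * (3/2) ^ n / b ^ Suc n"
        using bound[of n] bb by (intro divide_right_mono) auto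
      finally show ?thesis unfolding geom .
    qed
    then show "\<exists>N. \<forall>n\<ge>N. norm (r (Suc n) - r n) \<le> K / b * (3/2 / b) ^ n" by blast
  qed
  then have "(\<lambda>n. \<Sum>i<n. r (Suc i) - r i) \<longlonglongrightarrow> (\<Sum>n. r (Suc n) - r n)"
    by (rule summable_LIMSEQ)
  then have "(\<lambda>n. (r n - r 0) + r 0) \<longlonglongrightarrow> (\<Sum>n. r (Suc n) - r n) + r 0"
    by (intro tendsto_add tendsto_const) (simp add: sum_lessThan_telescope)
  then obtain C where C: "r \<longlonglongrightarrow> C" by auto
  define \<Lambda> where "\<Lambda> n = b * q (n + 2) + b * (b - 1) * q (n + 1) + q n" for n
  have "\<Lambda> (Suc n) = b * \<Lambda> n" for n
  proof -
    have "\<Lambda> (Suc n) - b * \<Lambda> n = - (b * b * b - b * b - b - 1) * q (n + 1)"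
      using rec[of n] by (simp add: \<Lambda>_def algebra_simps eval_nat_numeral)
    then show ?thesis using b3 by simp
  qed
  then have \<Lambda>: "\<Lambda> n = b ^ n * \<Lambda> 0" for n by (induction n) auto
  have "b * b\<^sup>2 * r (n + 2) + b * (b - 1) * b * r (n + 1) + r n = \<Lambda> n / b ^ n" for n
    using bb by (simp add: r_def \<Lambda>_def field_simps power2_eq_square)
  then have const: "b * b\<^sup>2 * r (n + 2) + b * (b - 1) * b * r (n + 1) + r n = \<Lambda> 0" for n
    using bb \<Lambda>[of n] by simp
  have "(\<lambda>n. b * b\<^sup>2 * r (n + 2) + b * (b - 1) * b * r (n + 1) + r n)
      \<longlonglongrightarrow> b * b\<^sup>2 * C + b * (b - 1) * b * C + C"
    by (intro tendsto_intros LIMSEQ_ignore_initial_segment C)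
  then have eq: "\<Lambda> 0 = (b * b\<^sup>2 + b * (b - 1) * b + 1) * C"
    unfolding const by (simp add: LIMSEQ_const_iff algebra_simps)
  have "0 < \<Lambda> 0" unfolding \<Lambda>_def using pos bb by (intro add_pos_pos mult_pos_pos) auto
  moreover have "0 < b * b\<^sup>2 + b * (b - 1) * b + 1" using bb by (intro add_pos_pos mult_pos_pos) auto
  ultimately have "0 < C" unfolding eq by (simp add: zero_less_mult_iff)
  then show ?thesis using C unfolding r_def b_def by blast
qed

section \<open>Limits of the normalised counts\<close>

definition density :: "nat \<Rightarrow> real \<Rightarrow> real" where
  "density n x = real (cnt (int n) {0..x}) / minrem_lambda ^ n"

lemma inverse_lambda_power_tendsto_0: "(\<lambda>n. c / minrem_lambda ^ n) \<longlonglongrightarrow> 0"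
  using minrem_lambda(2) by (intro LIMSEQ_divide_realpow_zero) auto

lemma density_half_limit: "\<exists>C>0. (\<lambda>n. density n (1/2)) \<longlonglongrightarrow> C"
proof -
  \<comment> \<open>The offset 2 makes every \<open>q n\<close> positive and makes the recurrence,
    valid from level 5 on, hold for all \<open>n\<close>.\<close>
  define q where "q n = real (cnt (int (n + 2)) {0<..1/2})" for n
  have "q (n + 3) = q (n + 2) + q (n + 1) + q n" for n
    using cnt_tribonacci[of "int n + 5"] by (simp add: q_def add.commute)
  moreover have "0 < q n" for n using cnt_pos[of "int (n + 2)"] by (simp add: q_def)
  ultimately obtain C where C: "C > 0" "(\<lambda>n. q n / minrem_lambda ^ n) \<longlonglongrightarrow> C"
    using tribonacci_growth[of q] by blast
  \<comment> \<open>The second summand is the contribution of the point 0 and vanishes in the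
    limit.\<close>
  have "density (n + 2) (1/2) = (q n / minrem_lambda ^ n + 1 / minrem_lambda ^ n) / minrem_lambda ^ 2" for n
    using minrem_lambda(2)
    by (simp add: density_def q_def cnt_closed power_add power2_eq_square field_simps)
  then have "(\<lambda>n. density (n + 2) (1/2)) \<longlonglongrightarrow> (C + 0) / minrem_lambda ^ 2"
    using C(2) inverse_lambda_power_tendsto_0[of 1] minrem_lambda(2)
    by (simp only:) (intro tendsto_intros; simp)
  then have "(\<lambda>n. density n (1/2)) \<longlonglongrightarrow> C / minrem_lambda ^ 2"
    by (simp only: add_0_right LIMSEQ_offset)
  moreover have "0 < C / minrem_lambda ^ 2" using C(1) minrem_lambda(2) by simp
  ultimately show ?thesis by blast
qed

lemma density_0: "density n 0 = 1 / minrem_lambda ^ n"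
proof -
  have "level (int n) {0} = {0}" by (auto simp: level_def minrem_sum_0)
  then show ?thesis by (simp add: density_def cnt_def)
qed

text \<open>Both counting relations, normalised and written with a common sign
  \<open>\<sigma>\<close>. They are exact up to one point: the end point \<open>y\<close> for sign
  1, the point 0 for sign -1. The factor \<lambda>^2 compensates for the level
  \<open>n + 2\<close>.\<close>

lemma density_step:
  fixes a n :: nat and \<sigma> :: int
  assumes "2 \<le> a" "\<sigma> = 1 \<or> \<sigma> = -1 \<and> 3 \<le> a \<and> y < 1/2" "0 \<le> y" "y \<le> 1/2"
  shows "\<bar>density (n + a) (1 / (real a + of_int \<sigma> * y)) -
    (minrem_lambda ^ 2 * density (n + 2) (1/2) - of_int \<sigma> * density n y) / minrem_lambda ^ a\<bar>
    \<le> 1 / minrem_lambda ^ n"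
proof -
  define L where "L = minrem_lambda"
  have L: "1 \<le> L" "0 < L" using minrem_lambda(2) by (auto simp: L_def)
  define P where "P = real (cnt (int n + int a) {0..1 / (real a + of_int \<sigma> * y)})"
  define Q where "Q = real (cnt (int n + 2) {0..1/2})"
  define R where "R = real (cnt (int n) {0..y})"
  have main: "\<bar>P - (Q - of_int \<sigma> * R)\<bar> \<le> 1"
    using assms(2)
  proof
    assume s: "\<sigma> = 1"
    have "P + real (cnt (int n) {0..<y}) = Q"
      using cnt_step_plus[of "int n" "int a" y] assms s by (simp add: P_def Q_def flip: of_nat_add)
    then show ?thesis using cnt_half_open[OF assms(3,4), of "int n"] s by (simp add: R_def)
  next
    assume s: "\<sigma> = -1 \<and> 3 \<le> a \<and> y < 1/2"
    have "P + 1 = Q + R"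
      using cnt_step_minus[of "int n" "int a" y] assms s by (simp add: P_def Q_def R_def flip: of_nat_add of_nat_Suc)
    then show ?thesis using s by simp
  qed
  have "density (n + a) (1 / (real a + of_int \<sigma> * y)) = P / L ^ (n + a)"
    by (simp add: density_def P_def L_def)
  moreover have "(L ^ 2 * density (n + 2) (1/2) - of_int \<sigma> * density n y) / L ^ a
      = (Q - of_int \<sigma> * R) / L ^ (n + a)"
    using L by (simp add: density_def Q_def R_def L_def power_add power2_eq_square field_simps)
  ultimately have "\<bar>density (n + a) (1 / (real a + of_int \<sigma> * y)) -
    (L ^ 2 * density (n + 2) (1/2) - of_int \<sigma> * density n y) / L ^ a\<bar>
    = \<bar>P - (Q - of_int \<sigma> * R)\<bar> / L ^ (n + a)"
    using L by (simp add: abs_divide flip: diff_divide_distrib)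
  also have "\<dots> \<le> 1 / L ^ n"
    using main L by (intro frac_le) (auto intro: power_increasing)
  finally show ?thesis by (simp add: L_def)
qed

text \<open>Densities increase with \<open>x\<close>, so the convergent values at 1/2 bound them
  all. Uniformity in \<open>x\<close> lets one bound serve for every tail.\<close>

lemma density_bounded: "\<exists>B. \<forall>n x. 0 \<le> x \<longrightarrow> x \<le> 1/2 \<longrightarrow> \<bar>density n x\<bar> \<le> B"
proof -
  obtain C where "(\<lambda>n. density n (1/2)) \<longlonglongrightarrow> C" using density_half_limit by blast
  then have "Bseq (\<lambda>n. density n (1/2))" using convergent_imp_Bseq convergentI by blast
  then obtain B where B: "\<And>n. norm (density n (1/2)) \<le> B" using BseqE by metis
  have "\<bar>density n x\<bar> \<le> B" if "0 \<le> x" "x \<le> 1/2" for n x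
  proof -
    have "cnt (int n) {0..x} \<le> cnt (int n) {0..1/2}" using that by (intro cnt_mono) auto
    then have "density n x \<le> density n (1/2)" unfolding density_def
      using minrem_lambda(2) by (intro divide_right_mono) auto
    moreover have "0 \<le> density n x" using minrem_lambda(2) by (simp add: density_def)
    ultimately show ?thesis using B[of n] by simp
  qed
  then show ?thesis by blast
qed

text \<open>Passing from \<open>x k\<close> to \<open>x (k+1)\<close> divides the error by \<open>\<lambda>\<^sup>a\<close> with \<open>a \<ge> 2\<close> up to a null
  sequence, so an error that is bounded uniformly in \<open>k\<close> vanishes. Finite expansions are padded
  by \<open>x k = 0\<close>.\<close>

lemma density_limit:
  fixes x v :: "nat \<Rightarrow> real" and a :: "nat \<Rightarrow> nat" and \<sigma> :: "nat \<Rightarrow> int"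
  assumes C: "(\<lambda>n. density n (1/2)) \<longlonglongrightarrow> C"
    and range: "\<And>k. 0 \<le> x k \<and> x k \<le> 1/2" "\<And>k. \<bar>v k\<bar> \<le> V"
    and step: "\<And>k. x k = 0 \<and> v k = 0 \<or>
      2 \<le> a k \<and> (\<sigma> k = 1 \<or> \<sigma> k = -1 \<and> 3 \<le> a k \<and> x (Suc k) < 1/2) \<and>
      x k = 1 / (real (a k) + of_int (\<sigma> k) * x (Suc k)) \<and>
      v k = (minrem_lambda ^ 2 * C - of_int (\<sigma> k) * v (Suc k)) / minrem_lambda ^ a k"
  shows "(\<lambda>n. density n (x k)) \<longlonglongrightarrow> v k"
proof -
  define L where "L = minrem_lambda"
  have L: "9/5 \<le> L" using minrem_lambda(2) by (simp add: L_def)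
  obtain B0 where B0: "\<And>n k. \<bar>density n (x k)\<bar> \<le> B0" using density_bounded range(1) by meson
  define B where "B = B0 + V"
  have VB: "0 \<le> V" "0 \<le> B0" using range(2)[of 0] B0[of 0 0] by linarith+
  \<comment> \<open>The added 1 makes the initial error bound strictly positive, so that null
    sequences eventually fall below its fractions.\<close>
  have B: "\<bar>density n (x k) - v k\<bar> \<le> B + 1" for n k
    using B0[of n k] range(2)[of k] by (simp add: B_def)
  \<comment> \<open>Following \<open>j\<close> tails halves the error bound \<open>j\<close> times.
    The statement ranges over all \<open>k\<close> because each step refers to
    \<open>Suc k\<close>.\<close>
  have approx: "\<forall>\<^sub>F n in sequentially. \<bar>density n (x k) - v k\<bar> \<le> (B + 1) * (1/2) ^ j" for j k
  proof (induction j arbitrary: k)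
    case 0
    then show ?case using B by simp
  next
    case (Suc j)
    define e where "e = (B + 1) * (1/2) ^ j"
    have e: "0 < e" using VB by (simp add: e_def B_def)
    from step[of k] show ?case
    proof
      assume 0: "x k = 0 \<and> v k = 0"
      have "\<forall>\<^sub>F n in sequentially. \<bar>1 / minrem_lambda ^ n - 0\<bar> < e / 2"
        using inverse_lambda_power_tendsto_0[of 1, THEN tendstoD, of "e / 2"] e by (simp add: dist_real_def)
      then show ?case by eventually_elim (use 0 in \<open>simp add: density_0 e_def\<close>)
    next
      assume s: "2 \<le> a k \<and> (\<sigma> k = 1 \<or> \<sigma> k = -1 \<and> 3 \<le> a k \<and> x (Suc k) < 1/2) \<and>
        x k = 1 / (real (a k) + of_int (\<sigma> k) * x (Suc k)) \<and>
        v k = (minrem_lambda ^ 2 * C - of_int (\<sigma> k) * v (Suc k)) / minrem_lambda ^ a k"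
      have La: "3 \<le> L ^ a k"
      proof -
        have "3 \<le> L ^ 2" using mult_mono[OF L L] L by (simp add: power2_eq_square)
        also have "\<dots> \<le> L ^ a k" using L s by (intro power_increasing) auto
        finally show ?thesis .
      qed
      have "(\<lambda>n. 1 / L ^ n + L ^ 2 * \<bar>density (n + 2) (1/2) - C\<bar>) \<longlonglongrightarrow> 0 + L ^ 2 * \<bar>C - C\<bar>"
        unfolding L_def
        by (intro tendsto_add tendsto_mult tendsto_rabs tendsto_diff tendsto_const
            inverse_lambda_power_tendsto_0 LIMSEQ_ignore_initial_segment[OF C])
      \<comment> \<open>Error budget: e/8 for the vanishing terms and e/3 for the old error divided
        by \<open>L ^ a k\<close> \<ge> 3, together below e/2.\<close>
      then have "\<forall>\<^sub>F n in sequentially. 1 / L ^ n + L ^ 2 * \<bar>density (n + 2) (1/2) - C\<bar> < e / 8"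
        using e by (intro order_tendstoD(2)) auto
      moreover have "\<forall>\<^sub>F n in sequentially. \<bar>density n (x (Suc k)) - v (Suc k)\<bar> \<le> e"
        using Suc.IH unfolding e_def .
      ultimately have "\<forall>\<^sub>F n in sequentially. \<bar>density (n + a k) (x k) - v k\<bar> \<le> e / 2"
      proof eventually_elim
        case (elim n)
        define D where "D = (L ^ 2 * density (n + 2) (1/2) - of_int (\<sigma> k) * density n (x (Suc k))) / L ^ a k"
        have 1: "\<bar>density (n + a k) (x k) - D\<bar> \<le> 1 / L ^ n"
          using density_step[of "a k" "\<sigma> k" "x (Suc k)" n] s range(1)[of "Suc k"]
          by (simp add: D_def L_def)
        define X where "X = \<bar>L ^ 2 * (density (n + 2) (1/2) - C)\<bar>"
        define Y where "Y = \<bar>of_int (\<sigma> k) * (density n (x (Suc k)) - v (Suc k))\<bar>"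
        have X: "X = L ^ 2 * \<bar>density (n + 2) (1/2) - C\<bar>" using L by (simp add: X_def abs_mult)
        have Y: "Y = \<bar>density n (x (Suc k)) - v (Suc k)\<bar>" using s by (auto simp: Y_def)
        have "D - v k = (L ^ 2 * (density (n + 2) (1/2) - C)
            - of_int (\<sigma> k) * (density n (x (Suc k)) - v (Suc k))) / L ^ a k"
        proof -
          have "v k = (L ^ 2 * C - of_int (\<sigma> k) * v (Suc k)) / L ^ a k" using s by (simp add: L_def)
          then show ?thesis
            by (simp only: D_def diff_divide_distrib[symmetric]) (simp add: algebra_simps)
        qed
        then have "\<bar>D - v k\<bar> = \<bar>L ^ 2 * (density (n + 2) (1/2) - C)
            - of_int (\<sigma> k) * (density n (x (Suc k)) - v (Suc k))\<bar> / L ^ a k"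
          using L by (simp add: abs_divide)
        also have "\<dots> \<le> (X + Y) / L ^ a k"
          using La unfolding X_def Y_def by (intro divide_right_mono abs_triangle_ineq4) auto
        also have "\<dots> \<le> (X + Y) / 3"
          using La by (intro divide_left_mono) (auto simp: X_def Y_def)
        also have "\<dots> \<le> X + e / 3" using elim(2) unfolding Y by (simp add: X_def)
        finally show ?case using 1 elim(1) e unfolding X by linarith
      qed
      then have "\<forall>\<^sub>F n in sequentially. \<bar>density n (x k) - v k\<bar> \<le> e / 2"
        by (rule eventually_sequentially_seg[of "\<lambda>n. \<bar>density n (x k) - v k\<bar> \<le> e / 2" "a k", THEN iffD1])
      then show ?case by (simp add: e_def)
    qed
  qed
  show ?thesis
  proof (rule tendstoI)
    fix e :: real assume e: "0 < e"
    have "(\<lambda>j. (B + 1) * (1/2) ^ j) \<longlonglongrightarrow> (B + 1) * 0"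
      by (intro tendsto_intros LIMSEQ_realpow_zero) auto
    then have "\<forall>\<^sub>F j in sequentially. (B + 1) * (1/2) ^ j < e" using e by (intro order_tendstoD(2)) auto
    then obtain j where j: "(B + 1) * (1/2) ^ j < e" by (auto simp: eventually_sequentially)
    show "\<forall>\<^sub>F n in sequentially. dist (density n (x k)) (v k) < e"
      using approx[of k j] by eventually_elim (use j in \<open>simp add: dist_real_def\<close>)
  qed
qed

lemma density_half_open_limit:
  assumes "0 \<le> y" "y \<le> 1/2" "(\<lambda>n. density n y) \<longlonglongrightarrow> v"
  shows "(\<lambda>n. real (cnt (int n) {0..<y}) / minrem_lambda ^ n) \<longlonglongrightarrow> v"
proof (rule real_tendsto_sandwich)
  show "(\<lambda>n. density n y - 1 / minrem_lambda ^ n) \<longlonglongrightarrow> v"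
    using tendsto_diff[OF assms(3) inverse_lambda_power_tendsto_0[of 1]] by simp
  show "\<forall>\<^sub>F n in sequentially. density n y - 1 / minrem_lambda ^ n
      \<le> real (cnt (int n) {0..<y}) / minrem_lambda ^ n"
  proof (intro always_eventually allI)
    fix n
    have "real (cnt (int n) {0..y}) - 1 \<le> real (cnt (int n) {0..<y})"
      using cnt_half_open(2)[OF assms(1,2), of "int n"] by linarith
    then show "density n y - 1 / minrem_lambda ^ n \<le> real (cnt (int n) {0..<y}) / minrem_lambda ^ n"
      unfolding density_def diff_divide_distrib[symmetric]
      using minrem_lambda(2) by (intro divide_right_mono) auto
  qed
  show "\<forall>\<^sub>F n in sequentially. real (cnt (int n) {0..<y}) / minrem_lambda ^ n \<le> density n y"
    using cnt_half_open(1)[OF assms(1,2)] minrem_lambda(2)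
    by (intro always_eventually allI) (auto simp: density_def intro!: divide_right_mono)
qed (rule assms(3))

section \<open>Reflection at 1/2 and the ratios on [0, 1]\<close>

lemma level_reflect:
  assumes "0 \<le> u" "u \<le> 1/2"
  shows "level (M + 1) {1 - u<..1} = (\<lambda>t. 1 - t) ` level M {0..<u}"
proof -
  have "(\<lambda>t. 1 - t) ` {0..<u} = {1 - u<..1}"
  proof (intro equalityI subsetI)
    fix x assume "x \<in> {1 - u<..1}"
    then show "x \<in> (\<lambda>t. 1 - t) ` {0..<u}" by (intro image_eqI[of _ _ "1 - x"]) auto
  qed auto
  moreover have "level (M + 1) ((\<lambda>t. 1 - t) ` {0..<u}) = (\<lambda>t. 1 - t) ` level M {0..<u}"
  proof (rule level_image)
    fix t assume t: "t \<in> {0..<u}"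
    show "1 - t \<in> \<rat> \<longleftrightarrow> t \<in> \<rat>" using Rats_diff_int_iff[of 1 t] by simp
    assume "t \<in> \<rat>"
    then show "minrem_sum (1 - t) = minrem_sum t + 1"
      using minrem_sum_add_int[of "-t" 1] minrem_sum_minus[of t] t assms by simp
  qed
  ultimately show ?thesis by simp
qed

lemma card_level_reflect:
  assumes "0 \<le> u" "u \<le> 1/2"
  shows "finite (level (M + 1) {1 - u<..1})" "card (level (M + 1) {1 - u<..1}) = cnt M {0..<u}"
proof -
  have "finite (level M {0..<u})" by (rule finite_level) (use assms in auto)
  then show "finite (level (M + 1) {1 - u<..1})" using assms by (simp add: level_reflect)
  show "card (level (M + 1) {1 - u<..1}) = cnt M {0..<u}"
    using assms by (simp add: level_reflect cnt_def card_image inj_on_def)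
qed

lemma minrem_Z_eq: "minrem_Z n = level (int n + 1) {0..1}"
  by (auto simp: minrem_Z_def level_def)

text \<open>Split [0, 1] after 1/2. Reflection carries (1/2, 1] to [0, 1/2) and lowers the level
  from \<open>n + 1\<close> to \<open>n\<close>.\<close>

lemma card_minrem_Z: "card (minrem_Z n) = cnt (int (Suc n)) {0..1/2} + cnt (int n) {0..<1/2}"
  and finite_minrem_Z: "finite (minrem_Z n)"
proof -
  have Z: "minrem_Z n = level (int n + 1) {0..1/2} \<union> level (int n + 1) {1 - 1/2<..1}"
    unfolding minrem_Z_eq by (subst level_union[symmetric], rule arg_cong[where f = "level _"]) auto
  have fin: "finite (level (int n + 1) {0..1/2})" by (rule finite_level) auto
  show "finite (minrem_Z n)" unfolding Z using fin card_level_reflect(1)[of "1/2"] by simp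
  have "level (int n + 1) {0..1/2} \<inter> level (int n + 1) {1 - 1/2<..1} = {}" by (auto simp: level_def)
  then show "card (minrem_Z n) = cnt (int (Suc n)) {0..1/2} + cnt (int n) {0..<1/2}"
    unfolding Z using fin card_level_reflect[of "1/2" "int n"]
    by (simp add: card_Un_disjoint cnt_def add.commute)
qed

text \<open>The half at level \<open>n + 1\<close> contributes \<lambda> C, the reflected half at
  level \<open>n\<close> contributes C.\<close>

lemma card_minrem_Z_limit:
  assumes "(\<lambda>n. density n (1/2)) \<longlonglongrightarrow> C"
  shows "(\<lambda>n. real (card (minrem_Z n)) / minrem_lambda ^ n) \<longlonglongrightarrow> C * (minrem_lambda + 1)"
proof -
  have "real (card (minrem_Z n)) / minrem_lambda ^ n = minrem_lambda * density (Suc n) (1/2)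
      + real (cnt (int n) {0..<1/2}) / minrem_lambda ^ n" for n
    using minrem_lambda(2) by (simp add: card_minrem_Z density_def add_divide_distrib)
  moreover have "(\<lambda>n. minrem_lambda * density (Suc n) (1/2)
      + real (cnt (int n) {0..<1/2}) / minrem_lambda ^ n) \<longlonglongrightarrow> minrem_lambda * C + C"
    using assms by (intro tendsto_intros density_half_open_limit LIMSEQ_Suc) auto
  ultimately show ?thesis by (simp add: algebra_simps)
qed

lemma minrem_ratio_low:
  assumes C: "0 < C" "(\<lambda>n. density n (1/2)) \<longlonglongrightarrow> C"
    and x: "0 \<le> x" "x \<le> 1/2" "(\<lambda>n. density n x) \<longlonglongrightarrow> v"
  shows "(\<lambda>n. minrem_ratio n x) \<longlonglongrightarrow> minrem_lambda * v / (C * (minrem_lambda + 1))"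
proof -
  have set: "{\<xi> \<in> minrem_Z n. \<xi> \<le> x} = level (int (Suc n)) {0..x}" for n
    using x by (auto simp: minrem_Z_eq level_def)
  have "minrem_ratio n x = (minrem_lambda * density (Suc n) x)
      / (real (card (minrem_Z n)) / minrem_lambda ^ n)" for n
    using minrem_lambda(2) unfolding minrem_ratio_def set by (simp add: density_def cnt_def)
  moreover have "(\<lambda>n. (minrem_lambda * density (Suc n) x) / (real (card (minrem_Z n)) / minrem_lambda ^ n))
      \<longlonglongrightarrow> (minrem_lambda * v) / (C * (minrem_lambda + 1))"
    using C minrem_lambda(2) by (intro tendsto_intros card_minrem_Z_limit LIMSEQ_Suc x) auto
  ultimately show ?thesis by simp
qed

text \<open>Counts the complement (1 - u, 1], which reflects to \<open>{0..<u}\<close> at level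
  \<open>n\<close>. The factor \<lambda> of the lower half is therefore absent.\<close>

lemma minrem_ratio_high:
  assumes C: "0 < C" "(\<lambda>n. density n (1/2)) \<longlonglongrightarrow> C"
    and u: "0 \<le> u" "u \<le> 1/2" "(\<lambda>n. density n u) \<longlonglongrightarrow> v"
  shows "(\<lambda>n. minrem_ratio n (1 - u)) \<longlonglongrightarrow> 1 - v / (C * (minrem_lambda + 1))"
proof -
  have pos: "0 < card (minrem_Z n)" for n
  proof -
    have "0 \<in> minrem_Z n" by (simp add: minrem_Z_def minrem_sum_0)
    then show ?thesis using finite_minrem_Z[of n] by (auto simp: card_gt_0_iff)
  qed
  have card: "real (card {\<xi> \<in> minrem_Z n. \<xi> \<le> 1 - u})
      = real (card (minrem_Z n)) - real (cnt (int n) {0..<u})" for n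
  proof -
    have "minrem_Z n = {\<xi> \<in> minrem_Z n. \<xi> \<le> 1 - u} \<union> level (int n + 1) {1 - u<..1}"
      using u by (auto simp: minrem_Z_eq level_def)
    moreover have "{\<xi> \<in> minrem_Z n. \<xi> \<le> 1 - u} \<inter> level (int n + 1) {1 - u<..1} = {}"
      by (auto simp: level_def)
    ultimately have "card (minrem_Z n) = card {\<xi> \<in> minrem_Z n. \<xi> \<le> 1 - u} + cnt (int n) {0..<u}"
      using card_Un_disjoint[of "{\<xi> \<in> minrem_Z n. \<xi> \<le> 1 - u}" "level (int n + 1) {1 - u<..1}"]
        finite_minrem_Z[of n] card_level_reflect[OF u(1,2), of "int n"] by simp
    then show ?thesis by simp
  qed
  have "minrem_ratio n (1 - u) = 1 - (real (cnt (int n) {0..<u}) / minrem_lambda ^ n)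
      / (real (card (minrem_Z n)) / minrem_lambda ^ n)" for n
    using minrem_lambda(2) pos[of n] unfolding minrem_ratio_def card by (simp add: diff_divide_distrib)
  moreover have "(\<lambda>n. 1 - (real (cnt (int n) {0..<u}) / minrem_lambda ^ n)
      / (real (card (minrem_Z n)) / minrem_lambda ^ n)) \<longlonglongrightarrow> 1 - v / (C * (minrem_lambda + 1))"
    using C minrem_lambda(2) u
    by (intro tendsto_intros card_minrem_Z_limit density_half_open_limit) auto
  ultimately show ?thesis by simp
qed

section \<open>Tails of an expansion and the series\<close>

text \<open>Only the limit of the whole fraction is given. Solving the recursion yields the limit of
  the reciprocals of the next tail, and the upper bound on tails keeps that limit nonzero, so it can
  be inverted.\<close>

lemma minrem_cf_infinite_tails:
  assumes "minrem_admissible \<infinity> a \<epsilon>" "cf_value a \<epsilon> 0 \<longlonglongrightarrow> x"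
  shows "\<exists>T. cf_value a \<epsilon> k \<longlonglongrightarrow> T \<and> (0 < k \<longrightarrow> 2 \<le> T)"
proof (induction k)
  case 0
  then show ?case using assms(2) by auto
next
  case (Suc k)
  then obtain T where T: "cf_value a \<epsilon> k \<longlonglongrightarrow> T" by blast
  let ?t = "cf_value a \<epsilon> (Suc k)"
  have b: "2 \<le> ?t m" "?t m \<le> of_int (a (Suc k)) + 1/2" for m
    using cf_value_tail_bounds[OF assms(1), of "Suc k" m] by auto
  have e: "\<epsilon> (Suc k) = 1 \<or> \<epsilon> (Suc k) = -1"
    using assms(1) unfolding minrem_admissible_def by auto
  have "inverse (?t m) = of_int (\<epsilon> (Suc k)) * (cf_value a \<epsilon> k (Suc m) - of_int (a k))" for m
    using e by (auto simp: inverse_eq_divide)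
  then have inv: "(\<lambda>m. inverse (?t m)) \<longlonglongrightarrow> of_int (\<epsilon> (Suc k)) * (T - of_int (a k))"
    by (simp only:) (intro tendsto_intros LIMSEQ_Suc T)
  define y where "y = of_int (\<epsilon> (Suc k)) * (T - of_int (a k))"
  have "inverse (of_int (a (Suc k)) + 1/2) \<le> inverse (?t m)" for m
    using b[of m] by (intro le_imp_inverse_le) auto
  then have "inverse (of_int (a (Suc k)) + 1/2) \<le> y"
    using inv unfolding y_def by (intro LIMSEQ_le_const) auto
  moreover have "0 < inverse (of_int (a (Suc k)) + 1/2 :: real)" using b[of 0] by simp
  ultimately have "y \<noteq> 0" by linarith
  with inv have "(\<lambda>m. inverse (inverse (?t m))) \<longlonglongrightarrow> inverse y"
    unfolding y_def by (intro tendsto_inverse)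
  then have lim: "?t \<longlonglongrightarrow> inverse y" by simp
  moreover have "2 \<le> inverse y" using b(1) by (intro LIMSEQ_le_const[OF lim]) auto
  ultimately show ?case by blast
qed

text \<open>Complete quotients of finite and infinite expansions in one form. Strictness under the
  sign -1 rests on the rule for the last quotient when the expansion ends there; it supplies the
  condition \<open>y < 1/2\<close> of the minus step.\<close>

lemma minrem_cf_tails:
  assumes "minrem_cf x l a \<epsilon>"
  shows "\<exists>T. T 0 = x \<and>
    (\<forall>k. enat k \<le> l \<longrightarrow> T k = of_int (a k) + (if enat (Suc k) \<le> l then of_int (\<epsilon> (Suc k)) / T (Suc k) else 0)) \<and>
    (\<forall>k\<ge>1. enat k \<le> l \<longrightarrow> 2 \<le> T k \<and> (\<epsilon> k = -1 \<longrightarrow> 2 < T k))"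
proof (cases l)
  case (enat s)
  have adm: "minrem_admissible (enat s) a \<epsilon>" and x: "x = cf_value a \<epsilon> 0 s"
    using assms enat by (auto simp: minrem_cf_def)
  define T where "T k = cf_value a \<epsilon> k (s - k)" for k
  have "T k = of_int (a k) + (if Suc k \<le> s then of_int (\<epsilon> (Suc k)) / T (Suc k) else 0)" if "k \<le> s" for k
  proof (cases "k = s")
    case False
    then have "s - k = Suc (s - Suc k)" using that by simp
    then show ?thesis using that False by (simp add: T_def)
  qed (simp add: T_def)
  moreover have "2 \<le> T k \<and> (\<epsilon> k = -1 \<longrightarrow> 2 < T k)" if "1 \<le> k" "k \<le> s" for k
  proof (cases "k = s")
    case True
    have "a s = 2 \<longrightarrow> \<epsilon> s = 1" "2 \<le> a s" using adm that True unfolding minrem_admissible_def by auto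
    then show ?thesis using True by (auto simp: T_def)
  next
    case False
    then show ?thesis using cf_value_tail_bounds[OF adm that(1), of "s - k"] that by (simp add: T_def)
  qed
  moreover have "T 0 = x" using x by (simp add: T_def)
  ultimately show ?thesis using enat by (intro exI[of _ T]) simp
next
  case infinity
  have adm: "minrem_admissible \<infinity> a \<epsilon>" and x: "cf_value a \<epsilon> 0 \<longlonglongrightarrow> x"
    using assms infinity by (auto simp: minrem_cf_def)
  obtain T where T: "\<And>k. cf_value a \<epsilon> k \<longlonglongrightarrow> T k" "\<And>k. 0 < k \<Longrightarrow> 2 \<le> T k"
    using minrem_cf_infinite_tails[OF adm x] by metis
  have rec: "T k = of_int (a k) + of_int (\<epsilon> (Suc k)) / T (Suc k)" for k
  proof (rule LIMSEQ_unique)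
    show "(\<lambda>m. cf_value a \<epsilon> k (Suc m)) \<longlonglongrightarrow> T k" using T(1) by (rule LIMSEQ_Suc)
    have "T (Suc k) \<noteq> 0" using T(2)[of "Suc k"] by simp
    then show "(\<lambda>m. cf_value a \<epsilon> k (Suc m)) \<longlonglongrightarrow> of_int (a k) + of_int (\<epsilon> (Suc k)) / T (Suc k)"
      unfolding cf_value.simps by (intro tendsto_intros T)
  qed
  have "2 < T k" if "1 \<le> k" for k
  proof -
    have adm: "2 \<le> a k" "\<epsilon> (Suc k) \<in> {1,-1}" "2 \<le> a k + \<epsilon> (Suc k)"
      using adm that unfolding minrem_admissible_def by auto
    have inv: "0 < 1 / T (Suc k)" "1 / T (Suc k) \<le> 1/2" using T(2)[of "Suc k"] by (auto simp: field_simps)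
    consider "\<epsilon> (Suc k) = 1" | "\<epsilon> (Suc k) = -1" "3 \<le> a k" using adm by auto
    then show ?thesis
    proof cases
      case 1
      have "T k = of_int (a k) + 1 / T (Suc k)" "(2::real) \<le> of_int (a k)" using rec[of k] 1 adm by auto
      then show ?thesis using inv by linarith
    next
      case 2
      have "T k = of_int (a k) - 1 / T (Suc k)" "(3::real) \<le> of_int (a k)" using rec[of k] 2 by auto
      then show ?thesis using inv by linarith
    qed
  qed
  moreover have "T 0 = x" using LIMSEQ_unique[OF T(1) x] .
  moreover have "T k = of_int (a k) + (if enat (Suc k) \<le> l then of_int (\<epsilon> (Suc k)) / T (Suc k) else 0)" for k
    using rec[of k] infinity by simp
  ultimately show ?thesis using T(2) by (intro exI[of _ T] conjI allI impI) auto
qed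

text \<open>Padding with zeros beyond \<open>l\<close> lets one infinite sum cover finite and
  infinite expansions.\<close>

definition cf_series :: "enat \<Rightarrow> (nat \<Rightarrow> int) \<Rightarrow> (nat \<Rightarrow> int) \<Rightarrow> nat \<Rightarrow> real" where
  "cf_series l a \<epsilon> j = (if enat j \<le> l then cf_term a \<epsilon> j else 0)"

text \<open>The value of the series for the tail starting at \<open>a (k+1)\<close>: the factors undo \<open>E\<close> and \<open>A\<close>
  of the part that was cut off.\<close>

definition cf_tail_sum :: "enat \<Rightarrow> (nat \<Rightarrow> int) \<Rightarrow> (nat \<Rightarrow> int) \<Rightarrow> nat \<Rightarrow> real" where
  "cf_tail_sum l a \<epsilon> k =
    of_int (cf_E \<epsilon> (Suc k)) * minrem_lambda powi cf_A a k * (\<Sum>j. cf_series l a \<epsilon> (j + Suc k))"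

lemma abs_cf_E:
  assumes "minrem_admissible l a \<epsilon>" "enat k \<le> l"
  shows "\<bar>cf_E \<epsilon> k\<bar> = 1"
  using assms(2)
proof (induction k)
  case (Suc k)
  then have "\<bar>cf_E \<epsilon> k\<bar> = 1" by (cases l) auto
  moreover have "\<bar>\<epsilon> (Suc k)\<bar> = 1" using assms(1) Suc.prems unfolding minrem_admissible_def
    by (auto dest!: spec[of _ "Suc k"])
  ultimately show ?case by (simp add: cf_E_def abs_mult)
qed (simp add: cf_E_def)

lemma cf_A_Suc: "cf_A a (Suc k) = cf_A a k + a (Suc k)"
  by (simp add: cf_A_def)

lemma cf_A_growth:
  assumes "minrem_admissible l a \<epsilon>" "enat (k + j) \<le> l"
  shows "cf_A a k + 2 * int j \<le> cf_A a (k + j)"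
  using assms(2)
proof (induction j)
  case (Suc j)
  then have "enat (k + j) \<le> l" by (cases l) auto
  moreover have "2 \<le> a (Suc (k + j))" using assms(1) Suc.prems unfolding minrem_admissible_def
    by (auto dest!: spec[of _ "Suc (k + j)"])
  ultimately show ?case using Suc.IH by (simp add: cf_A_Suc)
qed simp

text \<open>Each further quotient is at least 2 and \<lambda>^2 \<ge> 2, so every term beyond index
  \<open>k\<close> gains a factor 1/2. Scaling by the power for \<open>k\<close> makes the bound
  independent of \<open>k\<close>.\<close>

lemma cf_series_bound:
  assumes "minrem_admissible l a \<epsilon>"
  shows "minrem_lambda powi cf_A a k * \<bar>cf_series l a \<epsilon> (j + Suc k)\<bar> \<le> (1/2) ^ Suc j"
proof (cases "enat (j + Suc k) \<le> l")
  case True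
  define L where "L = minrem_lambda"
  have L: "9/5 \<le> L" using minrem_lambda(2) by (simp add: L_def)
  have growth: "cf_A a k + 2 * int (Suc j) \<le> cf_A a (j + Suc k)"
    using cf_A_growth[OF assms, of k "Suc j"] True by (simp add: add.commute)
  have "2 \<le> L ^ 2" using mult_mono[OF L L] L by (simp add: power2_eq_square)
  have E: "\<bar>of_int (cf_E \<epsilon> (j + Suc k)) :: real\<bar> = 1"
    using abs_cf_E[OF assms True] by (metis of_int_1 of_int_abs)
  have "L powi cf_A a k * \<bar>cf_series l a \<epsilon> (j + Suc k)\<bar> = L powi cf_A a k / L powi cf_A a (j + Suc k)"
    using True L E by (simp add: cf_series_def cf_term_def abs_divide L_def)
  also have "\<dots> = L powi (cf_A a k - cf_A a (j + Suc k))" using L by (simp add: power_int_diff)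
  also have "\<dots> \<le> L powi (- int (2 * Suc j))" using growth L by (intro power_int_increasing) auto
  also have "\<dots> = 1 / (L ^ 2) ^ Suc j"
    by (simp only: power_int_minus power_int_of_nat power_mult inverse_eq_divide)
  also have "\<dots> \<le> 1 / 2 ^ Suc j"
    using \<open>2 \<le> L ^ 2\<close> L by (intro divide_left_mono power_mono mult_pos_pos zero_less_power) auto
  finally show ?thesis by (simp add: L_def power_divide)
qed (simp add: cf_series_def)

lemma summable_half_powers: "summable (\<lambda>j. (1/2) ^ Suc j :: real)"
  using power_half_series sums_summable by blast

lemma summable_cf_series:
  assumes "minrem_admissible l a \<epsilon>"
  shows "summable (\<lambda>j. cf_series l a \<epsilon> (j + k))"
proof -
  have "summable (\<lambda>j. minrem_lambda powi cf_A a 0 * cf_series l a \<epsilon> (j + Suc 0))"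
    using cf_series_bound[OF assms, of 0] minrem_lambda(2)
    by (intro summable_comparison_test[OF _ summable_half_powers]) (auto simp: abs_mult)
  then have "summable (\<lambda>j. cf_series l a \<epsilon> (j + Suc 0))"
    using minrem_lambda(2) by (simp add: summable_cmult_iff)
  then show ?thesis by (simp only: summable_iff_shift)
qed

lemma cf_tail_sum_beyond:
  assumes "\<not> enat (Suc k) \<le> l"
  shows "cf_tail_sum l a \<epsilon> k = 0"
proof -
  have "\<not> enat (j + Suc k) \<le> l" for j using assms by (cases l) auto
  then show ?thesis by (simp add: cf_tail_sum_def cf_series_def)
qed

text \<open>Supplies the bound uniform in \<open>k\<close> that the contraction argument
  requires.\<close>

lemma abs_cf_tail_sum_le:
  assumes "minrem_admissible l a \<epsilon>"
  shows "\<bar>cf_tail_sum l a \<epsilon> k\<bar> \<le> 1"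
proof (cases "enat (Suc k) \<le> l")
  case True
  have E: "\<bar>of_int (cf_E \<epsilon> (Suc k)) :: real\<bar> = 1"
    using abs_cf_E[OF assms True] by (metis of_int_1 of_int_abs)
  have "\<bar>cf_tail_sum l a \<epsilon> k\<bar> = norm (\<Sum>j. minrem_lambda powi cf_A a k * cf_series l a \<epsilon> (j + Suc k))"
    using E minrem_lambda(2) summable_cf_series[OF assms, of "Suc k"]
    by (simp add: cf_tail_sum_def abs_mult suminf_mult)
  also have "\<dots> \<le> (\<Sum>j. (1/2) ^ Suc j)"
    using cf_series_bound[OF assms, of k] minrem_lambda(2)
    by (intro norm_suminf_le summable_half_powers) (auto simp: abs_mult)
  also have "\<dots> = 1" using power_half_series sums_unique by metis
  finally show ?thesis .
qed (simp add: cf_tail_sum_beyond)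

text \<open>Split off the first term and use that \<open>cf_E\<close> squares to 1. This is the
  limiting step relation divided by C \<lambda>^2. Past the end the default sign 1 is harmless,
  since it multiplies a zero tail sum.\<close>

lemma cf_tail_sum_rec:
  assumes "minrem_admissible l a \<epsilon>" "enat (Suc k) \<le> l"
  shows "cf_tail_sum l a \<epsilon> k = (1 - of_int (if enat (Suc (Suc k)) \<le> l then \<epsilon> (Suc (Suc k)) else 1)
    * cf_tail_sum l a \<epsilon> (Suc k)) / minrem_lambda powi a (Suc k)"
proof -
  define L where "L = minrem_lambda"
  have L: "L \<noteq> 0" using minrem_lambda(2) by (auto simp: L_def)
  define R where "R k = (\<Sum>j. cf_series l a \<epsilon> (j + Suc k))" for k
  have R: "R k = cf_term a \<epsilon> (Suc k) + R (Suc k)"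
    using suminf_split_head[OF summable_cf_series[OF assms(1), of "Suc k"]] assms(2)
    by (simp add: R_def cf_series_def)
  have E: "of_int (cf_E \<epsilon> (Suc k)) * of_int (cf_E \<epsilon> (Suc k)) = (1::real)"
    using abs_cf_E[OF assms] by (auto simp: abs_if split: if_splits simp flip: of_int_mult)
  have A: "L powi cf_A a (Suc k) = L powi cf_A a k * L powi a (Suc k)"
    using L by (simp add: cf_A_Suc power_int_add)
  have "cf_tail_sum l a \<epsilon> k = of_int (cf_E \<epsilon> (Suc k)) * L powi cf_A a k * (cf_term a \<epsilon> (Suc k) + R (Suc k))"
    unfolding cf_tail_sum_def R[unfolded R_def] by (simp add: L_def R_def)
  also have "\<dots> = 1 / L powi a (Suc k) + of_int (cf_E \<epsilon> (Suc k)) * L powi cf_A a k * R (Suc k)"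
    using E L by (simp add: cf_term_def distrib_left A flip: L_def)
  also have "\<dots> = (1 + of_int (cf_E \<epsilon> (Suc k)) * L powi cf_A a (Suc k) * R (Suc k)) / L powi a (Suc k)"
    using L by (simp add: A add_divide_distrib)
  also have "of_int (cf_E \<epsilon> (Suc k)) * L powi cf_A a (Suc k) * R (Suc k)
      = - of_int (if enat (Suc (Suc k)) \<le> l then \<epsilon> (Suc (Suc k)) else 1) * cf_tail_sum l a \<epsilon> (Suc k)"
  proof (cases "enat (Suc (Suc k)) \<le> l")
    case True
    then have "\<epsilon> (Suc (Suc k)) \<in> {1,-1}" using assms(1) unfolding minrem_admissible_def by auto
    then have "cf_E \<epsilon> (Suc k) = - \<epsilon> (Suc (Suc k)) * cf_E \<epsilon> (Suc (Suc k))"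
      by (auto simp: cf_E_def)
    then show ?thesis using True by (simp add: cf_tail_sum_def R_def L_def)
  next
    case False
    then have "\<not> enat (j + Suc (Suc k)) \<le> l" for j by (cases l) auto
    then show ?thesis using False by (simp add: cf_tail_sum_def cf_series_def R_def)
  qed
  finally show ?thesis by (simp add: L_def)
qed

text \<open>Here \<open>u\<close> is the distance from \<open>x\<close> to \<open>a 0\<close>,
  namely the reciprocal of the first complete quotient, or 0 if there is none. The reciprocals and
  the scaled tail sums satisfy the same step relation as the limits of the densities.\<close>

lemma minrem_tail_density:
  assumes cf: "minrem_cf x l a \<epsilon>" and C: "(\<lambda>n. density n (1/2)) \<longlonglongrightarrow> C"
  shows "\<exists>u. 0 \<le> u \<and> u \<le> 1/2 \<and> (\<epsilon> 1 = -1 \<longrightarrow> u < 1/2) \<and> (u = 0 \<longleftrightarrow> l = 0) \<and>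
    x = of_int (a 0) + of_int (\<epsilon> 1) * u \<and>
    (\<lambda>n. density n u) \<longlonglongrightarrow> C * minrem_lambda ^ 2 * cf_tail_sum l a \<epsilon> 0"
proof -
  have adm: "minrem_admissible l a \<epsilon>" using cf by (simp add: minrem_cf_def)
  obtain T where T: "T 0 = x"
    "\<And>k. enat k \<le> l \<Longrightarrow> T k = of_int (a k) + (if enat (Suc k) \<le> l then of_int (\<epsilon> (Suc k)) / T (Suc k) else 0)"
    "\<And>k. 1 \<le> k \<Longrightarrow> enat k \<le> l \<Longrightarrow> 2 \<le> T k \<and> (\<epsilon> k = -1 \<longrightarrow> 2 < T k)"
    using minrem_cf_tails[OF cf] by metis
  define u where "u k = (if enat (Suc k) \<le> l then 1 / T (Suc k) else 0)" for k
  define b where "b k = nat (a (Suc k))" for k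
  \<comment> \<open>Indices are shifted: step \<open>k\<close> uses quotient \<open>k + 1\<close>
    and sign \<open>k + 2\<close>. At the last quotient the default 1 multiplies
    \<open>u (Suc k) = 0\<close>.\<close>
  define \<sigma> where "\<sigma> k = (if enat (Suc (Suc k)) \<le> l then \<epsilon> (Suc (Suc k)) else 1)" for k
  define v where "v k = C * minrem_lambda ^ 2 * cf_tail_sum l a \<epsilon> k" for k
  have range: "0 \<le> u k \<and> u k \<le> 1/2" for k
    using T(3)[of "Suc k"] by (auto simp: u_def field_simps)
  have strict: "u k < 1/2" if "enat (Suc k) \<le> l" "\<epsilon> (Suc k) = -1" for k
    using T(3)[of "Suc k"] that by (auto simp: u_def field_simps)
  have bound: "\<bar>v k\<bar> \<le> \<bar>C * minrem_lambda ^ 2\<bar>" for k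
    using mult_left_mono[OF abs_cf_tail_sum_le[OF adm, of k], of "\<bar>C * minrem_lambda ^ 2\<bar>"]
    by (simp add: v_def abs_mult)
  have step: "u k = 0 \<and> v k = 0 \<or>
      2 \<le> b k \<and> (\<sigma> k = 1 \<or> \<sigma> k = -1 \<and> 3 \<le> b k \<and> u (Suc k) < 1/2) \<and>
      u k = 1 / (real (b k) + of_int (\<sigma> k) * u (Suc k)) \<and>
      v k = (minrem_lambda ^ 2 * C - of_int (\<sigma> k) * v (Suc k)) / minrem_lambda ^ b k" for k
  proof (cases "enat (Suc k) \<le> l")
    case False
    then show ?thesis by (simp add: u_def v_def cf_tail_sum_beyond)
  next
    case True
    have ak: "2 \<le> a (Suc k)" using adm True unfolding minrem_admissible_def by auto
    then have b: "2 \<le> b k" "int (b k) = a (Suc k)" "real (b k) = of_int (a (Suc k))" by (auto simp: b_def)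
    have s: "\<sigma> k = 1 \<or> \<sigma> k = -1 \<and> 3 \<le> b k \<and> u (Suc k) < 1/2"
    proof (cases "enat (Suc (Suc k)) \<le> l")
      case 2: True
      then have "\<epsilon> (Suc (Suc k)) = 1 \<or> \<epsilon> (Suc (Suc k)) = -1 \<and> 3 \<le> a (Suc k)"
      proof -
        have "\<epsilon> (Suc (Suc k)) \<in> {1,-1}" "2 \<le> a (Suc k) + \<epsilon> (Suc (Suc k))"
          using adm 2 unfolding minrem_admissible_def by auto
        then show ?thesis by auto
      qed
      then show ?thesis using 2 strict[OF 2] b(2) by (auto simp: \<sigma>_def)
    qed (simp add: \<sigma>_def)
    have uk: "u k = 1 / (real (b k) + of_int (\<sigma> k) * u (Suc k))"
      using True T(2)[OF True] b(3) by (simp add: u_def \<sigma>_def)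
    have "minrem_lambda powi a (Suc k) = minrem_lambda ^ b k"
      using b(2) by (metis power_int_of_nat)
    then have "cf_tail_sum l a \<epsilon> k
        = (1 - of_int (\<sigma> k) * cf_tail_sum l a \<epsilon> (Suc k)) / minrem_lambda ^ b k"
      using cf_tail_sum_rec[OF adm True] by (simp add: \<sigma>_def)
    then have "v k = (minrem_lambda ^ 2 * C - of_int (\<sigma> k) * v (Suc k)) / minrem_lambda ^ b k"
      by (simp add: v_def algebra_simps)
    then show ?thesis using b(1) s uk by blast
  qed
  have lim: "(\<lambda>n. density n (u 0)) \<longlonglongrightarrow> v 0"
    by (rule density_limit[where x = u and v = v and a = b and \<sigma> = \<sigma>, OF C range bound step])
  show ?thesis
  proof (intro exI[of _ "u 0"] conjI impI)
    have l0: "enat (Suc 0) \<le> l \<longleftrightarrow> l \<noteq> 0"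
      by (cases l) (auto simp: zero_enat_def)
    then show "u 0 = 0 \<longleftrightarrow> l = 0" using T(3)[of 1] by (auto simp: u_def)
    show "u 0 < 1/2" if "\<epsilon> 1 = -1"
      using strict[of 0] that by (cases "enat (Suc 0) \<le> l") (auto simp: u_def)
    show "x = of_int (a 0) + of_int (\<epsilon> 1) * u 0"
      using T(1) T(2)[of 0] by (auto simp: u_def zero_enat_def[symmetric])
  qed (use range lim in \<open>auto simp: v_def\<close>)
qed

theorem theorem1:
  fixes x :: real and l :: enat and a \<epsilon> :: "nat \<Rightarrow> int"
  assumes "0 \<le> x" and "x \<le> 1"
    and "minrem_cf x l a \<epsilon>"
  shows "(\<lambda>n. minrem_ratio n x) \<longlonglongrightarrow> minrem_F x \<and>
    (\<forall>s. l = enat s \<longrightarrow>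
       minrem_F x = of_int (a 0) - minrem_c * minrem_lambda * (\<Sum>j=1..s. cf_term a \<epsilon> j)) \<and>
    (l = \<infinity> \<longrightarrow>
       summable (\<lambda>j. cf_term a \<epsilon> (Suc j)) \<and>
       minrem_F x = of_int (a 0) - minrem_c * minrem_lambda * (\<Sum>j. cf_term a \<epsilon> (Suc j)))"
proof -
  have adm: "minrem_admissible l a \<epsilon>" using assms(3) by (simp add: minrem_cf_def)
  define L where "L = minrem_lambda"
  have L: "L ^ 3 = L ^ 2 + L + 1" "9/5 \<le> L" using minrem_lambda by (auto simp: L_def)
  obtain C where C: "0 < C" "(\<lambda>n. density n (1/2)) \<longlonglongrightarrow> C" using density_half_limit by blast
  define G where "G = cf_tail_sum l a \<epsilon> 0"
  obtain u where u: "0 \<le> u" "u \<le> 1/2" "\<epsilon> 1 = -1 \<longrightarrow> u < 1/2" "u = 0 \<longleftrightarrow> l = 0"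
    "x = of_int (a 0) + of_int (\<epsilon> 1) * u" "(\<lambda>n. density n u) \<longlonglongrightarrow> C * L ^ 2 * G"
    using minrem_tail_density[OF assms(3) C(2)] unfolding L_def G_def by blast
  define \<Sigma> where "\<Sigma> = (\<Sum>j. cf_series l a \<epsilon> (j + Suc 0))"
  have G: "G = - of_int (\<epsilon> 1) * L powi a 0 * \<Sigma>"
    by (simp add: G_def \<Sigma>_def cf_tail_sum_def cf_E_def cf_A_def L_def)
  have \<Sigma>0: "\<Sigma> = 0" if "l = 0"
    using that by (simp add: \<Sigma>_def cf_series_def zero_enat_def)
  have e: "\<epsilon> 1 = 1 \<or> \<epsilon> 1 = -1" if "l \<noteq> 0"
  proof -
    have "enat 1 \<le> l" using that by (cases l) (auto simp: zero_enat_def)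
    then show ?thesis using adm unfolding minrem_admissible_def by auto
  qed
  \<comment> \<open>The cubic turns 1 / (\<lambda> - 1) into \<lambda>^2 / (\<lambda> + 1), the
    constant that the ratio limits produce.\<close>
  have c: "minrem_c * L = L ^ 3 / (L + 1)"
  proof -
    have "L * (L + 1) = L ^ 3 * (L - 1)" using L(1) by algebra
    then show ?thesis using L(2) by (simp add: minrem_c_def L_def[symmetric] field_simps)
  qed
  have LC: "L + 1 \<noteq> 0" "C \<noteq> 0" using L C by auto
  have lim: "(\<lambda>n. minrem_ratio n x) \<longlonglongrightarrow> of_int (a 0) - minrem_c * L * \<Sigma>"
  proof -
    have low: "(\<lambda>n. minrem_ratio n u) \<longlonglongrightarrow> minrem_c * L * G"
      using minrem_ratio_low[OF C u(1,2,6)] LC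
      by (simp add: c L_def[symmetric] power3_eq_cube power2_eq_square mult_ac)
    have high: "(\<lambda>n. minrem_ratio n (1 - u)) \<longlonglongrightarrow> 1 - minrem_c * G"
    proof -
      have c': "minrem_c = L ^ 2 / (L + 1)"
        using c L(2) by (simp add: power3_eq_cube power2_eq_square eq_divide_eq flip: mult.assoc)
      have "minrem_c * G = C * L ^ 2 * G / (C * (L + 1))" unfolding c' using LC(2) by simp
      then show ?thesis using minrem_ratio_high[OF C u(1,2,6)] by (simp only: L_def)
    qed
    \<comment> \<open>Because \<open>x\<close> lies in [0, 1], these are the integers 0 and 1, the
      points above \<open>a 0 = 0\<close>, and the points below \<open>a 0 = 1\<close>, to be
      treated by reflection.\<close>
    consider "u = 0" "l = 0" | "0 < u" "\<epsilon> 1 = 1" | "0 < u" "u < 1/2" "\<epsilon> 1 = -1"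
    proof (cases "l = 0")
      case False
      then have "0 < u" using u(1,4) by simp
      then show ?thesis using e[OF False] u(3) that by blast
    qed (use u(4) that in blast)
    then show ?thesis
    proof cases
      case 1
      then have "a 0 = 0 \<or> a 0 = 1" using assms(1,2) u(5) by auto
      then show ?thesis using low high 1 u(5) \<Sigma>0 G by auto
    next
      case 2
      then have x: "x = of_int (a 0) + u" using u(5) by simp
      have "- 1 < (of_int (a 0) :: real)" "(of_int (a 0) :: real) < 1" using x assms(1,2) u(2) 2 by linarith+
      then have "a 0 = 0" by linarith
      then show ?thesis using low 2 x G by simp
    next
      case 3
      then have x: "x = of_int (a 0) - u" using u(5) by simp
      have "0 < (of_int (a 0) :: real)" "(of_int (a 0) :: real) < 2" using x assms(1,2) 3 by linarith+
      then have "a 0 = 1" by linarith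
      \<comment> \<open>With \<open>a 0 = 1\<close> and sign -1, \<open>G\<close> equals
        \<open>L * \<Sigma>\<close>, which supplies the factor \<lambda> that \<open>high\<close>
        lacks.\<close>
      then show ?thesis using high 3 x G by (simp add: mult_ac)
    qed
  qed
  then have F: "minrem_F x = of_int (a 0) - minrem_c * L * \<Sigma>"
    unfolding minrem_F_def by (rule limI)
  have fin: "\<Sigma> = (\<Sum>j=1..s. cf_term a \<epsilon> j)" if "l = enat s" for s
  proof -
    have "\<Sigma> = (\<Sum>j\<in>{..<s}. cf_series l a \<epsilon> (j + Suc 0))"
      unfolding \<Sigma>_def by (rule suminf_finite) (auto simp: cf_series_def that)
    also have "\<dots> = (\<Sum>j\<in>{..<s}. cf_term a \<epsilon> (Suc j))" by (simp add: cf_series_def that)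
    also have "\<dots> = (\<Sum>j=1..s. cf_term a \<epsilon> j)" by (simp add: sum.atLeast1_atMost_eq)
    finally show ?thesis .
  qed
  have inf: "summable (\<lambda>j. cf_term a \<epsilon> (Suc j)) \<and> \<Sigma> = (\<Sum>j. cf_term a \<epsilon> (Suc j))" if "l = \<infinity>"
    using summable_cf_series[OF adm, of "Suc 0"] that by (simp add: \<Sigma>_def cf_series_def)
  show ?thesis using lim F fin inf unfolding L_def by auto
qed

end
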